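(* Let $k$ be a field, $P$ a poset with a height-difference function $\rho$, $M\in\mathrm{Rep}_k(P)$ and $r\ge0$. (1) The $r$-erosion $\mathsf E_rM$ is an $r$-erosion neighborhood of $M$. (2) If $N\in\mathrm{EN}_r(M)$, then $M$ and $N$ are $r$-height-interleaved with respect to $\rho$. In particular, $M$ and $\mathsf E_rM$ are $r$-height-interleaved with respect to $\rho$.
   Context: A poset $P$ is regarded as a category (a unique morphism $a\to b$ iff $a\le b$). $\mathrm{Rep}_k(P)=\mathrm{Fun}(P,\mathrm{Vect}_k)$ is the abelian category of functors from $P$ to $k$-vector spaces (of arbitrary dimension); kernels, cokernels and images are pointwise. A height-difference function on $P$ is a function $\rho:\{(a,b)\in P\times P: a\le b\}\to[0,\infty]$ with $\rho(a,a)=0$ for all $a$ and $\rho(a,c)\ge\rho(a,b)+\rho(b,c)$ whenever $a\le b\le c$. For $a\in P$ and real $r\ge 0$ put $a^{\downarrow_r}=\{x\in P: x\le a,\ \rho(x,a)\ge r\}$ and $a^{\uparrow_r}=\{x\in P: x\ge a,\ \rho(a,x)\ge r\}$ (full subposets). Endofunctors $\mathsf L_r=\mathsf L_r^\rho$ and $\mathsf R_r=\mathsf R_r^\rho$ of $\mathrm{Rep}_k(P)$: $(\mathsf L_rM)(a)=\operatorname{colim} M|_{a^{\downarrow_r}}$ and $(\mathsf R_rM)(a)=\lim M|_{a^{\uparrow_r}}$, with structure morphisms for $a\le b$ (using $a^{\downarrow_r}\subseteq b^{\downarrow_r}$, $b^{\uparrow_r}\subseteq a^{\uparrow_r}$)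 and the action on morphisms induced by the universal properties. Write $\alpha_{a,M}(x):M(x)\to(\mathsf L_rM)(a)$ ($x\in a^{\downarrow_r}$) and $\beta_{a,M}(y):(\mathsf R_rM)(a)\to M(y)$ ($y\in a^{\uparrow_r}$) for the canonical maps. The functor $\mathsf L_r$ is left adjoint to $\mathsf R_r$; for $p:M\to\mathsf R_rN$, its adjoint $p^\sharp:\mathsf L_rM\to N$ is the unique morphism with $p^\sharp(a)\circ\alpha_{a,M}(x)=\beta_{x,N}(a)\circ p(x)$ for all $a\in P$, $x\in a^{\downarrow_r}$. Let $\eta^{\mathsf L}_{r,M}:\mathsf L_rM\to M$ and $\eta^{\mathsf R}_{r,M}:M\to\mathsf R_rM$ be induced by the structure maps $M(x\le a)$, $x\in a^{\downarrow_r}$, respectively $M(a\le y)$, $y\in a^{\uparrow_r}$, and set $e_{r,M}=\eta^{\mathsf R}_{r,M}\circ\eta^{\mathsf L}_{r,M}:\mathsf L_rM\to\mathsf R_rM$. $M,N$ are $r$-height-interleaved with respect to $\rho$ if there are $p:M\to\mathsf R_rN$ and $q:N\to\mathsf R_rM$ with $e_{r,M}=q\circ p^\sharp$ and $e_{r,N}=p\circ q^\sharp$. The $r$-erosion of $M$ is $\mathsf E_rM=\operatorname{im}(e_{r,M})\subseteq\mathsf R_rM$. Put $\mathrm{Im}_rM=\operatorname{im}(\eta^{\mathsf L}_{r,M})\subseteq M$ and $\mathrm{Ker}_rM=\ker(\eta^{\mathsf R}_{r,M})\subseteq M$. An $r$-erosion neighborhood of $M$ is a module (up to isomorphism) of the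 form $M_1/M_2$ with submodules $M_2\subseteq M_1\subseteq M$ such that $\mathrm{Im}_rM\subseteq M_1$ and $M_2\subseteq\mathrm{Ker}_rM$; $\mathrm{EN}_r(M)$ is the set of isomorphism classes of $r$-erosion neighborhoods of $M$ (one writes $N\in\mathrm{EN}_r(M)$ if $N$ is isomorphic to one). *)

theory Defs
  imports "HOL-Library.Extended_Nonnegative_Real"
    "HOL-Algebra.Order" "HOL-Algebra.AbelCoset" "HOL-Algebra.Module"
begin

section \<open>Vector spaces and linear maps\<close>

text \<open>A vector space over a field \<open>k\<close> is a \<^locale>\<open>module\<close> over \<open>k\<close>.  Linear maps are taken to be
  extensional (\<open>undefined\<close> off the carrier), so that equality of morphisms is HOL equality and
  universal properties determine morphisms uniquely.  Composition is \<^const>\<open>compose\<close>.\<close>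

definition lin_maps :: "'k ring \<Rightarrow> ('k, 'v) module \<Rightarrow> ('k, 'w) module \<Rightarrow> ('v \<Rightarrow> 'w) set" where
  "lin_maps k V W = {h \<in> carrier V \<rightarrow>\<^sub>E carrier W.
     (\<forall>u\<in>carrier V. \<forall>v\<in>carrier V. h (u \<oplus>\<^bsub>V\<^esub> v) = h u \<oplus>\<^bsub>W\<^esub> h v) \<and>
     (\<forall>c\<in>carrier k. \<forall>v\<in>carrier V. h (c \<odot>\<^bsub>V\<^esub> v) = c \<odot>\<^bsub>W\<^esub> h v)}"

text \<open>The quotient module by a submodule \<open>H\<close>.  The library's module record extends the ring record,
  so modules formally carry a multiplication and a unit; these play no role and are left
  \<open>undefined\<close> here and below.\<close>

definition quot_mod :: "('k, 'v) module \<Rightarrow> 'v set \<Rightarrow> ('k, 'v set) module" where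
  "quot_mod V H =
     \<lparr>carrier = a_rcosets\<^bsub>V\<^esub> H, mult = undefined, one = undefined,
      zero = H, add = set_add V,
      smult = (\<lambda>c X. \<Union>v\<in>X. H +>\<^bsub>V\<^esub> (c \<odot>\<^bsub>V\<^esub> v))\<rparr>"


section \<open>Representations of a poset\<close>

text \<open>A functor from a poset to vector spaces: \<open>Ob M a\<close> is the space at \<open>a\<close>, and \<open>Mp M a b\<close> is the
  structure map for \<open>a \<sqsubseteq> b\<close> (its value is irrelevant for other pairs).\<close>

record ('p, 'k, 'v) rep =
  Ob :: "'p \<Rightarrow> ('k, 'v) module"
  Mp :: "'p \<Rightarrow> 'p \<Rightarrow> 'v \<Rightarrow> 'v"

definition is_rep :: "'k ring \<Rightarrow> 'p gorder \<Rightarrow> ('p, 'k, 'v) rep \<Rightarrow> bool" where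
  "is_rep k P M \<longleftrightarrow>
     (\<forall>a\<in>carrier P. module k (Ob M a)) \<and>
     (\<forall>a\<in>carrier P. \<forall>b\<in>carrier P. a \<sqsubseteq>\<^bsub>P\<^esub> b \<longrightarrow> Mp M a b \<in> lin_maps k (Ob M a) (Ob M b)) \<and>
     (\<forall>a\<in>carrier P. Mp M a a = (\<lambda>m\<in>carrier (Ob M a). m)) \<and>
     (\<forall>a\<in>carrier P. \<forall>b\<in>carrier P. \<forall>c\<in>carrier P. a \<sqsubseteq>\<^bsub>P\<^esub> b \<longrightarrow> b \<sqsubseteq>\<^bsub>P\<^esub> c \<longrightarrow>
        Mp M a c = compose (carrier (Ob M a)) (Mp M b c) (Mp M a b))"

definition rep_hom :: "'k ring \<Rightarrow> 'p gorder \<Rightarrow> ('p, 'k, 'v) rep \<Rightarrow> ('p, 'k, 'w) rep \<Rightarrow> ('p \<Rightarrow> 'v \<Rightarrow> 'w) set" where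
  "rep_hom k P M N = {f \<in> (\<Pi>\<^sub>E a\<in>carrier P. lin_maps k (Ob M a) (Ob N a)).
     \<forall>a\<in>carrier P. \<forall>b\<in>carrier P. a \<sqsubseteq>\<^bsub>P\<^esub> b \<longrightarrow>
       compose (carrier (Ob M a)) (Mp N a b) (f a) = compose (carrier (Ob M a)) (f b) (Mp M a b)}"

definition rep_id :: "'p gorder \<Rightarrow> ('p, 'k, 'v) rep \<Rightarrow> 'p \<Rightarrow> 'v \<Rightarrow> 'v" where
  "rep_id P M = (\<lambda>a\<in>carrier P. \<lambda>m\<in>carrier (Ob M a). m)"

text \<open>The composite \<open>g \<circ> f\<close>, where \<open>M\<close> is the domain of \<open>f\<close>.\<close>

definition rep_comp ::
    "'p gorder \<Rightarrow> ('p, 'k, 'u) rep \<Rightarrow> ('p \<Rightarrow> 'v \<Rightarrow> 'w) \<Rightarrow> ('p \<Rightarrow> 'u \<Rightarrow> 'v) \<Rightarrow> 'p \<Rightarrow> 'u \<Rightarrow> 'w" where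
  "rep_comp P M g f = (\<lambda>a\<in>carrier P. compose (carrier (Ob M a)) (g a) (f a))"

definition rep_iso :: "'k ring \<Rightarrow> 'p gorder \<Rightarrow> ('p, 'k, 'v) rep \<Rightarrow> ('p, 'k, 'w) rep \<Rightarrow> bool" where
  "rep_iso k P M N \<longleftrightarrow>
     (\<exists>f\<in>rep_hom k P M N. \<exists>g\<in>rep_hom k P N M.
        rep_comp P M g f = rep_id P M \<and> rep_comp P N f g = rep_id P N)"

definition is_subrep :: "'k ring \<Rightarrow> 'p gorder \<Rightarrow> ('p \<Rightarrow> 'v set) \<Rightarrow> ('p, 'k, 'v) rep \<Rightarrow> bool" where
  "is_subrep k P S M \<longleftrightarrow>
     (\<forall>a\<in>carrier P. submodule (S a) k (Ob M a)) \<and>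
     (\<forall>a\<in>carrier P. \<forall>b\<in>carrier P. a \<sqsubseteq>\<^bsub>P\<^esub> b \<longrightarrow> Mp M a b ` S a \<subseteq> S b)"

definition sub_rep :: "('p, 'k, 'v) rep \<Rightarrow> ('p \<Rightarrow> 'v set) \<Rightarrow> ('p, 'k, 'v) rep" where
  "sub_rep M S = \<lparr>Ob = (\<lambda>a. (Ob M a)\<lparr>carrier := S a\<rparr>),
                  Mp = (\<lambda>a b. restrict (Mp M a b) (S a))\<rparr>"

text \<open>The quotient \<open>M/S\<close>; its structure maps send \<open>S a + m\<close> to \<open>S b + M(a \<le> b)(m)\<close>.\<close>

definition quot_rep :: "('p, 'k, 'v) rep \<Rightarrow> ('p \<Rightarrow> 'v set) \<Rightarrow> ('p, 'k, 'v set) rep" where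
  "quot_rep M S = \<lparr>Ob = (\<lambda>a. quot_mod (Ob M a) (S a)),
     Mp = (\<lambda>a b. \<lambda>X\<in>a_rcosets\<^bsub>Ob M a\<^esub> S a. \<Union>m\<in>X. S b +>\<^bsub>Ob M b\<^esub> Mp M a b m)\<rparr>"

definition im_fam :: "('p, 'k, 'v) rep \<Rightarrow> ('p \<Rightarrow> 'v \<Rightarrow> 'w) \<Rightarrow> 'p \<Rightarrow> 'w set" where
  "im_fam M f a = f a ` carrier (Ob M a)"

definition ker_fam :: "('p, 'k, 'v) rep \<Rightarrow> ('p, 'k, 'w) rep \<Rightarrow> ('p \<Rightarrow> 'v \<Rightarrow> 'w) \<Rightarrow> 'p \<Rightarrow> 'v set" where
  "ker_fam M N f a = a_kernel (Ob M a) (Ob N a) (f a)"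


section \<open>Limits and colimits over full subposets\<close>

text \<open>Below, \<open>A \<subseteq> carrier P\<close> stands for the full subposet on \<open>A\<close>.  The colimit of \<open>M|\<^sub>A\<close> is the
  quotient of the direct sum (finitely supported families) by the submodule generated by the
  elements \<open>\<iota>\<^sub>x(m) - \<iota>\<^sub>y(M(x \<le> y)(m))\<close>; the limit is the module of compatible families.\<close>

definition dir_sum :: "'p set \<Rightarrow> ('p, 'k, 'v) rep \<Rightarrow> ('k, 'p \<Rightarrow> 'v) module" where
  "dir_sum A M =
     \<lparr>carrier = {s \<in> (\<Pi>\<^sub>E x\<in>A. carrier (Ob M x)). finite {x \<in> A. s x \<noteq> \<zero>\<^bsub>Ob M x\<^esub>}},
      mult = undefined, one = undefined,
      zero = (\<lambda>x\<in>A. \<zero>\<^bsub>Ob M x\<^esub>), add = (\<lambda>s t. \<lambda>x\<in>A. s x \<oplus>\<^bsub>Ob M x\<^esub> t x),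
      smult = (\<lambda>c s. \<lambda>x\<in>A. c \<odot>\<^bsub>Ob M x\<^esub> s x)\<rparr>"

definition dir_inj :: "'p set \<Rightarrow> ('p, 'k, 'v) rep \<Rightarrow> 'p \<Rightarrow> 'v \<Rightarrow> 'p \<Rightarrow> 'v" where
  "dir_inj A M x m = (\<lambda>y\<in>A. if y = x then m else \<zero>\<^bsub>Ob M y\<^esub>)"

definition colim_rel :: "'k ring \<Rightarrow> 'p gorder \<Rightarrow> 'p set \<Rightarrow> ('p, 'k, 'v) rep \<Rightarrow> ('p \<Rightarrow> 'v) set" where
  "colim_rel k P A M = \<Inter> {H. submodule H k (dir_sum A M) \<and>
     (\<forall>x\<in>A. \<forall>y\<in>A. x \<sqsubseteq>\<^bsub>P\<^esub> y \<longrightarrow> (\<forall>m\<in>carrier (Ob M x).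
        dir_inj A M x m \<ominus>\<^bsub>dir_sum A M\<^esub> dir_inj A M y (Mp M x y m) \<in> H))}"

definition colim :: "'k ring \<Rightarrow> 'p gorder \<Rightarrow> 'p set \<Rightarrow> ('p, 'k, 'v) rep \<Rightarrow> ('k, ('p \<Rightarrow> 'v) set) module" where
  "colim k P A M = quot_mod (dir_sum A M) (colim_rel k P A M)"

definition colim_in :: "'k ring \<Rightarrow> 'p gorder \<Rightarrow> 'p set \<Rightarrow> ('p, 'k, 'v) rep \<Rightarrow> 'p \<Rightarrow> 'v \<Rightarrow> ('p \<Rightarrow> 'v) set" where
  "colim_in k P A M x = (\<lambda>m\<in>carrier (Ob M x). colim_rel k P A M +>\<^bsub>dir_sum A M\<^esub> dir_inj A M x m)"

text \<open>The map out of the colimit induced by a cocone \<open>f\<close> with apex \<open>V\<close>, defined through the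
  universal property (the description is meaningful when \<open>f\<close> is a cocone of linear maps).\<close>

definition colim_desc ::
    "'k ring \<Rightarrow> 'p gorder \<Rightarrow> 'p set \<Rightarrow> ('p, 'k, 'v) rep \<Rightarrow> ('k, 'w) module \<Rightarrow> ('p \<Rightarrow> 'v \<Rightarrow> 'w) \<Rightarrow> ('p \<Rightarrow> 'v) set \<Rightarrow> 'w" where
  "colim_desc k P A M V f = (THE h. h \<in> lin_maps k (colim k P A M) V \<and>
     (\<forall>x\<in>A. compose (carrier (Ob M x)) h (colim_in k P A M x) = f x))"

definition limit :: "'p gorder \<Rightarrow> 'p set \<Rightarrow> ('p, 'k, 'v) rep \<Rightarrow> ('k, 'p \<Rightarrow> 'v) module" where
  "limit P A M =
     \<lparr>carrier = {s \<in> (\<Pi>\<^sub>E x\<in>A. carrier (Ob M x)).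
                   \<forall>x\<in>A. \<forall>y\<in>A. x \<sqsubseteq>\<^bsub>P\<^esub> y \<longrightarrow> Mp M x y (s x) = s y},
      mult = undefined, one = undefined,
      zero = (\<lambda>x\<in>A. \<zero>\<^bsub>Ob M x\<^esub>), add = (\<lambda>s t. \<lambda>x\<in>A. s x \<oplus>\<^bsub>Ob M x\<^esub> t x),
      smult = (\<lambda>c s. \<lambda>x\<in>A. c \<odot>\<^bsub>Ob M x\<^esub> s x)\<rparr>"

definition limit_out :: "'p gorder \<Rightarrow> 'p set \<Rightarrow> ('p, 'k, 'v) rep \<Rightarrow> 'p \<Rightarrow> ('p \<Rightarrow> 'v) \<Rightarrow> 'v" where
  "limit_out P A M y = (\<lambda>s\<in>carrier (limit P A M). s y)"

text \<open>The map into the limit induced by a cone \<open>f\<close> with apex \<open>V\<close>.\<close>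

definition limit_lift :: "'p set \<Rightarrow> ('k, 'w) module \<Rightarrow> ('p \<Rightarrow> 'w \<Rightarrow> 'v) \<Rightarrow> 'w \<Rightarrow> 'p \<Rightarrow> 'v" where
  "limit_lift A V f = (\<lambda>v\<in>carrier V. \<lambda>y\<in>A. f y v)"


section \<open>Height-difference functions\<close>

locale height_difference = partial_order P for P :: "'p gorder" (structure) +
  fixes rho :: "'p \<Rightarrow> 'p \<Rightarrow> ennreal"
  assumes rho_refl: "a \<in> carrier P \<Longrightarrow> rho a a = 0"
    and rho_superadditive:
      "\<lbrakk>a \<in> carrier P; b \<in> carrier P; c \<in> carrier P; a \<sqsubseteq> b; b \<sqsubseteq> c\<rbrakk>
       \<Longrightarrow> rho a b + rho b c \<le> rho a c"

definition down :: "'p gorder \<Rightarrow> ('p \<Rightarrow> 'p \<Rightarrow> ennreal) \<Rightarrow> real \<Rightarrow> 'p \<Rightarrow> 'p set" where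
  "down P rho r a = {x \<in> carrier P. x \<sqsubseteq>\<^bsub>P\<^esub> a \<and> ennreal r \<le> rho x a}"

definition up :: "'p gorder \<Rightarrow> ('p \<Rightarrow> 'p \<Rightarrow> ennreal) \<Rightarrow> real \<Rightarrow> 'p \<Rightarrow> 'p set" where
  "up P rho r a = {x \<in> carrier P. a \<sqsubseteq>\<^bsub>P\<^esub> x \<and> ennreal r \<le> rho a x}"

text \<open>The canonical maps \<open>\<alpha>\<^sub>a\<^sub>,\<^sub>M(x): M(x) \<rightarrow> (L\<^sub>r M)(a)\<close> and \<open>\<beta>\<^sub>a\<^sub>,\<^sub>M(y): (R\<^sub>r M)(a) \<rightarrow> M(y)\<close>.\<close>

definition alpha ::
    "'k ring \<Rightarrow> 'p gorder \<Rightarrow> ('p \<Rightarrow> 'p \<Rightarrow> ennreal) \<Rightarrow> real \<Rightarrow> ('p, 'k, 'v) rep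
     \<Rightarrow> 'p \<Rightarrow> 'p \<Rightarrow> 'v \<Rightarrow> ('p \<Rightarrow> 'v) set" where
  "alpha k P rho r M a x = colim_in k P (down P rho r a) M x"

definition beta ::
    "'p gorder \<Rightarrow> ('p \<Rightarrow> 'p \<Rightarrow> ennreal) \<Rightarrow> real \<Rightarrow> ('p, 'k, 'v) rep
     \<Rightarrow> 'p \<Rightarrow> 'p \<Rightarrow> ('p \<Rightarrow> 'v) \<Rightarrow> 'v" where
  "beta P rho r M a y = limit_out P (up P rho r a) M y"

definition L_rep ::
    "'k ring \<Rightarrow> 'p gorder \<Rightarrow> ('p \<Rightarrow> 'p \<Rightarrow> ennreal) \<Rightarrow> real \<Rightarrow> ('p, 'k, 'v) rep \<Rightarrow> ('p, 'k, ('p \<Rightarrow> 'v) set) rep" where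
  "L_rep k P rho r M =
     \<lparr>Ob = (\<lambda>a. colim k P (down P rho r a) M),
      Mp = (\<lambda>a b. colim_desc k P (down P rho r a) M (colim k P (down P rho r b) M)
                   (alpha k P rho r M b))\<rparr>"

definition R_rep ::
    "'p gorder \<Rightarrow> ('p \<Rightarrow> 'p \<Rightarrow> ennreal) \<Rightarrow> real \<Rightarrow> ('p, 'k, 'v) rep \<Rightarrow> ('p, 'k, 'p \<Rightarrow> 'v) rep" where
  "R_rep P rho r M =
     \<lparr>Ob = (\<lambda>a. limit P (up P rho r a) M),
      Mp = (\<lambda>a b. limit_lift (up P rho r b) (limit P (up P rho r a) M) (beta P rho r M a))\<rparr>"

text \<open>The adjoint \<open>L\<^sub>r M \<rightarrow> N\<close> of \<open>p: M \<rightarrow> R\<^sub>r N\<close>.\<close>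

definition sharp ::
    "'k ring \<Rightarrow> 'p gorder \<Rightarrow> ('p \<Rightarrow> 'p \<Rightarrow> ennreal) \<Rightarrow> real \<Rightarrow> ('p, 'k, 'v) rep \<Rightarrow> ('p, 'k, 'w) rep
     \<Rightarrow> ('p \<Rightarrow> 'v \<Rightarrow> 'p \<Rightarrow> 'w) \<Rightarrow> 'p \<Rightarrow> ('p \<Rightarrow> 'v) set \<Rightarrow> 'w" where
  "sharp k P rho r M N p = (THE q. q \<in> rep_hom k P (L_rep k P rho r M) N \<and>
     (\<forall>a\<in>carrier P. \<forall>x\<in>down P rho r a.
        compose (carrier (Ob M x)) (q a) (alpha k P rho r M a x)
        = compose (carrier (Ob M x)) (beta P rho r N x a) (p x)))"

definition eta_L ::
    "'k ring \<Rightarrow> 'p gorder \<Rightarrow> ('p \<Rightarrow> 'p \<Rightarrow> ennreal) \<Rightarrow> real \<Rightarrow> ('p, 'k, 'v) rep \<Rightarrow> 'p \<Rightarrow> ('p \<Rightarrow> 'v) set \<Rightarrow> 'v" where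
  "eta_L k P rho r M =
     (\<lambda>a\<in>carrier P. colim_desc k P (down P rho r a) M (Ob M a) (\<lambda>x. Mp M x a))"

definition eta_R ::
    "'p gorder \<Rightarrow> ('p \<Rightarrow> 'p \<Rightarrow> ennreal) \<Rightarrow> real \<Rightarrow> ('p, 'k, 'v) rep \<Rightarrow> 'p \<Rightarrow> 'v \<Rightarrow> 'p \<Rightarrow> 'v" where
  "eta_R P rho r M = (\<lambda>a\<in>carrier P. limit_lift (up P rho r a) (Ob M a) (\<lambda>y. Mp M a y))"

definition e_map ::
    "'k ring \<Rightarrow> 'p gorder \<Rightarrow> ('p \<Rightarrow> 'p \<Rightarrow> ennreal) \<Rightarrow> real \<Rightarrow> ('p, 'k, 'v) rep
     \<Rightarrow> 'p \<Rightarrow> ('p \<Rightarrow> 'v) set \<Rightarrow> 'p \<Rightarrow> 'v" where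
  "e_map k P rho r M = rep_comp P (L_rep k P rho r M) (eta_R P rho r M) (eta_L k P rho r M)"

definition height_interleaved ::
    "'k ring \<Rightarrow> 'p gorder \<Rightarrow> ('p \<Rightarrow> 'p \<Rightarrow> ennreal) \<Rightarrow> real \<Rightarrow> ('p, 'k, 'v) rep \<Rightarrow> ('p, 'k, 'w) rep \<Rightarrow> bool" where
  "height_interleaved k P rho r M N \<longleftrightarrow>
     (\<exists>p\<in>rep_hom k P M (R_rep P rho r N). \<exists>q\<in>rep_hom k P N (R_rep P rho r M).
        e_map k P rho r M = rep_comp P (L_rep k P rho r M) q (sharp k P rho r M N p) \<and>
        e_map k P rho r N = rep_comp P (L_rep k P rho r N) p (sharp k P rho r N M q))"


section \<open>Erosions and erosion neighborhoods\<close>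

definition erosion ::
    "'k ring \<Rightarrow> 'p gorder \<Rightarrow> ('p \<Rightarrow> 'p \<Rightarrow> ennreal) \<Rightarrow> real \<Rightarrow> ('p, 'k, 'v) rep \<Rightarrow> ('p, 'k, 'p \<Rightarrow> 'v) rep" where
  "erosion k P rho r M =
     sub_rep (R_rep P rho r M) (im_fam (L_rep k P rho r M) (e_map k P rho r M))"

definition Im_r ::
    "'k ring \<Rightarrow> 'p gorder \<Rightarrow> ('p \<Rightarrow> 'p \<Rightarrow> ennreal) \<Rightarrow> real \<Rightarrow> ('p, 'k, 'v) rep \<Rightarrow> 'p \<Rightarrow> 'v set" where
  "Im_r k P rho r M = im_fam (L_rep k P rho r M) (eta_L k P rho r M)"

definition Ker_r ::
    "'p gorder \<Rightarrow> ('p \<Rightarrow> 'p \<Rightarrow> ennreal) \<Rightarrow> real \<Rightarrow> ('p, 'k, 'v) rep \<Rightarrow> 'p \<Rightarrow> 'v set" where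
  "Ker_r P rho r M = ker_fam M (R_rep P rho r M) (eta_R P rho r M)"

text \<open>Instead of a set of isomorphism classes, \<open>EN\<close> is the (isomorphism-closed) set of
  representations, on an arbitrary carrier type \<open>'w\<close>, whose class is an erosion neighborhood.\<close>

definition EN ::
    "'k ring \<Rightarrow> 'p gorder \<Rightarrow> ('p \<Rightarrow> 'p \<Rightarrow> ennreal) \<Rightarrow> real \<Rightarrow> ('p, 'k, 'v) rep \<Rightarrow> ('p, 'k, 'w) rep set" where
  "EN k P rho r M = {N. is_rep k P N \<and>
     (\<exists>M1 M2. is_subrep k P M1 M \<and> is_subrep k P M2 M \<and>
        (\<forall>a\<in>carrier P. M2 a \<subseteq> M1 a) \<and>
        (\<forall>a\<in>carrier P. Im_r k P rho r M a \<subseteq> M1 a) \<and>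
        (\<forall>a\<in>carrier P. M2 a \<subseteq> Ker_r P rho r M a) \<and>
        rep_iso k P N (quot_rep (sub_rep M M1) M2))}"

end

theory Submission
  imports Defs
begin

text \<open>Suppose that \<open>N\<close> is isomorphic to \<open>M\<^sub>1/M\<^sub>2\<close>, with projection \<open>f: M\<^sub>1 \<rightarrow> N\<close>.  Structure maps
  \<open>M(a \<le> y)\<close> with \<open>\<rho>(a,y) \<ge> r\<close> land in \<open>Im\<^sub>r M \<subseteq> M\<^sub>1\<close>, so \<open>p m = (f (M(a \<le> y) m))\<^sub>y\<close> defines a morphism
  \<open>p: M \<rightarrow> R\<^sub>r N\<close>; since \<open>\<eta>\<^sup>R\<close> vanishes on \<open>M\<^sub>2 \<subseteq> Ker\<^sub>r M\<close>, the formula \<open>q (f m) = \<eta>\<^sup>R m\<close> defines a morphism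
  \<open>q: N \<rightarrow> R\<^sub>r M\<close>.  The canonical maps into a colimit are jointly epimorphic, so both interleaving
  identities need to be checked only on elements \<open>\<alpha>\<^sub>a(x)(m)\<close>, where they reduce to functoriality.
  Finally \<open>e\<^sub>r = \<eta>\<^sup>R \<circ> \<eta>\<^sup>L\<close> has image \<open>\<eta>\<^sup>R(Im\<^sub>r M)\<close>, so the erosion is the neighborhood with
  \<open>M\<^sub>1 = Im\<^sub>r M\<close> and \<open>M\<^sub>2 = Im\<^sub>r M \<inter> Ker\<^sub>r M\<close>.\<close>


section \<open>Linear maps and quotient modules\<close>

text \<open>The subposets \<open>down P rho r a\<close> need not be directed, so a general element
  of a colimit is a finite sum of elements \<open>alpha k P rho r M a x m\<close>, not a single one.
  This is why maps out of colimits are built on the direct sum and compared by an induction on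
  supports. \<open>colim_desc\<close> and \<open>sharp\<close> are definite descriptions: each
  yields information only once existence and uniqueness of the described map are both proved, and
  uniqueness as HOL functions rests on extensionality. The link between the two adjoints is the
  equivalence of \<open>x \<in> down P rho r a\<close> with \<open>a \<in> up P rho r x\<close>. It
  allows \<open>p x m\<close>, a family over \<open>up P rho r x\<close>, to be evaluated at
  \<open>a\<close>, and it puts M(a \<le> y)(m) into \<open>Im_r\<close> at y when
  \<open>y \<in> up P rho r a\<close>. In the interleaving argument the quotient is replaced by a
  surjection from \<open>M1\<close> onto N with kernel inside \<open>Ker_r\<close>, so no coset is
  handled there.\<close>

lemma lin_mapsI:
  assumes "h \<in> carrier V \<rightarrow>\<^sub>E carrier W"
    and "\<And>u v. \<lbrakk>u \<in> carrier V; v \<in> carrier V\<rbrakk> \<Longrightarrow> h (u \<oplus>\<^bsub>V\<^esub> v) = h u \<oplus>\<^bsub>W\<^esub> h v"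
    and "\<And>c v. \<lbrakk>c \<in> carrier k; v \<in> carrier V\<rbrakk> \<Longrightarrow> h (c \<odot>\<^bsub>V\<^esub> v) = c \<odot>\<^bsub>W\<^esub> h v"
  shows "h \<in> lin_maps k V W"
  using assms by (auto simp: lin_maps_def)

lemma lin_mapsD:
  assumes "h \<in> lin_maps k V W"
  shows lin_maps_closed: "v \<in> carrier V \<Longrightarrow> h v \<in> carrier W"
    and lin_maps_add: "\<lbrakk>u \<in> carrier V; v \<in> carrier V\<rbrakk> \<Longrightarrow> h (u \<oplus>\<^bsub>V\<^esub> v) = h u \<oplus>\<^bsub>W\<^esub> h v"
    and lin_maps_smult: "\<lbrakk>c \<in> carrier k; v \<in> carrier V\<rbrakk> \<Longrightarrow> h (c \<odot>\<^bsub>V\<^esub> v) = c \<odot>\<^bsub>W\<^esub> h v"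
    and lin_maps_extensional: "h \<in> extensional (carrier V)"
  using assms by (auto simp: lin_maps_def PiE_def)

lemma lin_maps_eqI:
  assumes "g \<in> lin_maps k V W" "h \<in> lin_maps k V W'"
    and "\<And>v. v \<in> carrier V \<Longrightarrow> g v = h v"
  shows "g = h"
  using assms by (meson extensionalityI lin_maps_extensional)

text \<open>\<open>compose\<close> is restricted to the carrier of U, so evaluating it at a sum or a
  multiple uses that U is closed under both.\<close>

lemma lin_maps_compose:
  assumes "g \<in> lin_maps k V W" "f \<in> lin_maps k U V"
    and "module k U"
  shows "compose (carrier U) g f \<in> lin_maps k U W"
proof -
  interpret U: module k U by fact
  show ?thesis
    by (rule lin_mapsI) (auto simp: compose_def lin_mapsD[OF assms(1)] lin_mapsD[OF assms(2)])
qed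

lemma lin_maps_zero:
  assumes "module k V" "module k W" "h \<in> lin_maps k V W"
  shows "h \<zero>\<^bsub>V\<^esub> = \<zero>\<^bsub>W\<^esub>"
proof -
  interpret V: module k V by fact
  interpret W: module k W by fact
  have "h \<zero>\<^bsub>V\<^esub> = h (\<zero>\<^bsub>k\<^esub> \<odot>\<^bsub>V\<^esub> \<zero>\<^bsub>V\<^esub>)" by simp
  also have "\<dots> = \<zero>\<^bsub>k\<^esub> \<odot>\<^bsub>W\<^esub> h \<zero>\<^bsub>V\<^esub>" by (rule lin_maps_smult[OF assms(3)]) auto
  also have "\<dots> = \<zero>\<^bsub>W\<^esub>" by (simp add: lin_maps_closed[OF assms(3)])
  finally show ?thesis .
qed

lemma lin_maps_minus:
  assumes "module k V" "module k W" "h \<in> lin_maps k V W"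
    and uv: "u \<in> carrier V" "v \<in> carrier V"
  shows "h (u \<ominus>\<^bsub>V\<^esub> v) = h u \<ominus>\<^bsub>W\<^esub> h v"
proof -
  interpret V: module k V by fact
  interpret W: module k W by fact
  \<comment> \<open>\<open>lin_maps\<close> speaks of sums and multiples only, so a negative is
    treated as the multiple by -1.\<close>
  have neg: "\<ominus>\<^bsub>V\<^esub> v = (\<ominus>\<^bsub>k\<^esub> \<one>\<^bsub>k\<^esub>) \<odot>\<^bsub>V\<^esub> v" "\<ominus>\<^bsub>W\<^esub> h v = (\<ominus>\<^bsub>k\<^esub> \<one>\<^bsub>k\<^esub>) \<odot>\<^bsub>W\<^esub> h v"
    using uv by (simp_all add: V.smult_l_minus W.smult_l_minus lin_maps_closed[OF assms(3)])
  show ?thesis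
    unfolding a_minus_def neg using uv by (simp add: lin_mapsD[OF assms(3)])
qed

lemma (in module) minus_eq_zero_iff:
  "\<lbrakk>u \<in> carrier M; v \<in> carrier M\<rbrakk> \<Longrightarrow> u \<ominus>\<^bsub>M\<^esub> v = \<zero>\<^bsub>M\<^esub> \<longleftrightarrow> u = v"
  by (metis M.add.inv_equality M.minus_eq M.minus_minus M.r_neg M.add.inv_closed)

text \<open>Negatives are multiples by -1, so closure under scalars supplies them.\<close>

lemma (in module) submoduleI_smult:
  assumes "H \<subseteq> carrier M" "\<zero>\<^bsub>M\<^esub> \<in> H"
    and "\<And>u v. \<lbrakk>u \<in> H; v \<in> H\<rbrakk> \<Longrightarrow> u \<oplus>\<^bsub>M\<^esub> v \<in> H"
    and "\<And>c v. \<lbrakk>c \<in> carrier R; v \<in> H\<rbrakk> \<Longrightarrow> c \<odot>\<^bsub>M\<^esub> v \<in> H"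
  shows "submodule H R M"
proof (rule submoduleI)
  fix v assume "v \<in> H"
  then show "\<ominus>\<^bsub>M\<^esub> v \<in> H"
    using assms(4)[of "\<ominus>\<^bsub>R\<^esub> \<one>\<^bsub>R\<^esub>" v] assms(1) by (auto simp: smult_l_minus)
qed (use assms in auto)

lemma submodule_zero: "submodule H k V \<Longrightarrow> \<zero>\<^bsub>V\<^esub> \<in> H"
  using subgroup.one_closed[OF submodule.axioms(1)] by fastforce

lemma submodule_restrict_carrier:
  assumes "module k V" "submodule S k V" "submodule H k V" "H \<subseteq> S"
  shows "submodule H k (V\<lparr>carrier := S\<rparr>)"
proof -
  interpret V: module k V by fact
  interpret S: module k "V\<lparr>carrier := S\<rparr>" by (rule submodule.submodule_is_module) fact+
  show ?thesis
    by (rule S.submoduleI_smult)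
      (use assms(4) V.submoduleE[OF assms(3)] submodule_zero[OF assms(3)] in auto)
qed

lemma submodule_inter:
  assumes "module k V" "submodule S k V" "submodule T k V"
  shows "submodule (S \<inter> T) k V"
proof -
  interpret V: module k V by fact
  show ?thesis
    by (rule V.submoduleI_smult)
      (use V.submoduleE[OF assms(2)] V.submoduleE[OF assms(3)] submodule_zero[OF assms(2)]
        submodule_zero[OF assms(3)] in auto)
qed

lemma submodule_image:
  assumes "module k V" "module k W" and h: "h \<in> lin_maps k V W"
  shows "submodule (h ` carrier V) k W"
proof -
  interpret V: module k V by fact
  interpret W: module k W by fact
  show ?thesis
  proof (rule W.submoduleI_smult)
    show "\<zero>\<^bsub>W\<^esub> \<in> h ` carrier V"
      using lin_maps_zero[OF assms] by (metis V.M.zero_closed imageI)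
  qed (use lin_mapsD[OF h] in \<open>auto simp flip: lin_maps_add[OF h] lin_maps_smult[OF h]\<close>)
qed

lemma a_kernel_iff: "v \<in> a_kernel V W h \<longleftrightarrow> v \<in> carrier V \<and> h v = \<zero>\<^bsub>W\<^esub>"
  by (auto simp: a_kernel_def')

lemma submodule_kernel:
  assumes "module k V" "module k W" and h: "h \<in> lin_maps k V W"
  shows "submodule (a_kernel V W h) k V"
proof -
  interpret V: module k V by fact
  interpret W: module k W by fact
  show ?thesis
    by (rule V.submoduleI_smult) (auto simp: a_kernel_iff lin_maps_zero[OF assms] lin_mapsD[OF h])
qed

section \<open>Quotient modules and their universal property\<close>

context
  fixes k :: "'k ring" and V :: "('k, 'v) module" and H
  assumes V: "module k V" and H: "submodule H k V"
begin

interpretation V: module k V by (rule V)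
interpretation H: submodule H k V by (rule H)
interpretation H: abelian_subgroup H V
  by (intro abelian_subgroupI3 additive_subgroupI H.subgroup_axioms V.M.abelian_group_axioms)

lemma carrier_quot_mod: "carrier (quot_mod V H) = (\<lambda>v. H +>\<^bsub>V\<^esub> v) ` carrier V"
  by (auto simp: quot_mod_def A_RCOSETS_def')

lemma coset_in_quot_mod: "v \<in> carrier V \<Longrightarrow> H +>\<^bsub>V\<^esub> v \<in> carrier (quot_mod V H)"
  by (simp add: carrier_quot_mod)

lemma coset_eq_iff:
  assumes "u \<in> carrier V" "v \<in> carrier V"
  shows "H +>\<^bsub>V\<^esub> u = H +>\<^bsub>V\<^esub> v \<longleftrightarrow> u \<ominus>\<^bsub>V\<^esub> v \<in> H"
proof -
  have "u \<ominus>\<^bsub>V\<^esub> v \<in> H \<longleftrightarrow> u \<in> H +>\<^bsub>V\<^esub> v"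
    using assms by (simp add: H.a_rcos_module V.M.minus_eq)
  also have "\<dots> \<longleftrightarrow> H +>\<^bsub>V\<^esub> u = H +>\<^bsub>V\<^esub> v"
    using assms H.a_repr_independence' H.a_rcos_self by metis
  finally show ?thesis by simp
qed

lemma coset_add:
  "\<lbrakk>u \<in> carrier V; v \<in> carrier V\<rbrakk>
    \<Longrightarrow> (H +>\<^bsub>V\<^esub> u) \<oplus>\<^bsub>quot_mod V H\<^esub> (H +>\<^bsub>V\<^esub> v) = H +>\<^bsub>V\<^esub> (u \<oplus>\<^bsub>V\<^esub> v)"
  by (simp add: quot_mod_def H.a_rcos_sum)

text \<open>The form in which the structure maps and scalars of a quotient are defined: a union over
  representatives of one and the same coset.\<close>

lemma coset_UN_eq:
  assumes "v \<in> carrier V" "\<And>u. \<lbrakk>u \<in> carrier V; u \<ominus>\<^bsub>V\<^esub> v \<in> H\<rbrakk> \<Longrightarrow> F u = F v"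
  shows "(\<Union>u\<in>H +>\<^bsub>V\<^esub> v. F u) = F v"
proof -
  have "F u = F v" if "u \<in> H +>\<^bsub>V\<^esub> v" for u
  proof (rule assms(2))
    show u: "u \<in> carrier V"
      using that assms(1) H.a_subset V.M.a_r_coset_subset_G by blast
    show "u \<ominus>\<^bsub>V\<^esub> v \<in> H"
      using that H.a_repr_independence' coset_eq_iff[OF u assms(1)] assms(1) by metis
  qed
  moreover have "v \<in> H +>\<^bsub>V\<^esub> v" using assms(1) by (rule H.a_rcos_self)
  ultimately show ?thesis by blast
qed

lemma coset_smult:
  assumes c: "c \<in> carrier k" and v: "v \<in> carrier V"
  shows "c \<odot>\<^bsub>quot_mod V H\<^esub> (H +>\<^bsub>V\<^esub> v) = H +>\<^bsub>V\<^esub> (c \<odot>\<^bsub>V\<^esub> v)"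
proof -
  have "(\<Union>u\<in>H +>\<^bsub>V\<^esub> v. H +>\<^bsub>V\<^esub> (c \<odot>\<^bsub>V\<^esub> u)) = H +>\<^bsub>V\<^esub> (c \<odot>\<^bsub>V\<^esub> v)"
  proof (rule coset_UN_eq[OF v])
    fix u assume u: "u \<in> carrier V" "u \<ominus>\<^bsub>V\<^esub> v \<in> H"
    have "c \<odot>\<^bsub>V\<^esub> u \<ominus>\<^bsub>V\<^esub> c \<odot>\<^bsub>V\<^esub> v = c \<odot>\<^bsub>V\<^esub> (u \<ominus>\<^bsub>V\<^esub> v)"
      using c u v by (simp add: a_minus_def V.smult_r_distr V.smult_r_minus)
    then show "H +>\<^bsub>V\<^esub> (c \<odot>\<^bsub>V\<^esub> u) = H +>\<^bsub>V\<^esub> (c \<odot>\<^bsub>V\<^esub> v)"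
      using c u v by (simp add: coset_eq_iff)
  qed
  then show ?thesis by (simp add: quot_mod_def)
qed

lemma zero_quot_mod: "\<zero>\<^bsub>quot_mod V H\<^esub> = H +>\<^bsub>V\<^esub> \<zero>\<^bsub>V\<^esub>"
  by (simp add: quot_mod_def H.a_subset)

lemma module_quot_mod: "module k (quot_mod V H)"
proof (rule moduleI)
  show "abelian_group (quot_mod V H)"
  proof (rule abelian_groupI)
    fix X assume "X \<in> carrier (quot_mod V H)"
    then obtain v where v: "v \<in> carrier V" "X = H +>\<^bsub>V\<^esub> v" by (auto simp: carrier_quot_mod)
    then have "(H +>\<^bsub>V\<^esub> (\<ominus>\<^bsub>V\<^esub> v)) \<oplus>\<^bsub>quot_mod V H\<^esub> X = \<zero>\<^bsub>quot_mod V H\<^esub>"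
      by (simp add: coset_add zero_quot_mod V.M.l_neg)
    with v show "\<exists>Y\<in>carrier (quot_mod V H). Y \<oplus>\<^bsub>quot_mod V H\<^esub> X = \<zero>\<^bsub>quot_mod V H\<^esub>"
      by (blast intro: coset_in_quot_mod)
  qed (auto simp: carrier_quot_mod coset_add zero_quot_mod V.M.a_ac)
qed (auto simp: carrier_quot_mod coset_add coset_smult V.R.cring_axioms V.smult_l_distr
    V.smult_r_distr V.smult_assoc1)

lemma quot_mod_proj: "(\<lambda>v\<in>carrier V. H +>\<^bsub>V\<^esub> v) \<in> lin_maps k V (quot_mod V H)"
  by (rule lin_mapsI) (auto simp: coset_in_quot_mod coset_add coset_smult)

text \<open>If u - v lies in H, then h u - h v = h (u - v) = 0, so h is constant on cosets and
  descends.\<close>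

lemma quot_mod_factor:
  assumes W: "module k W" and h: "h \<in> lin_maps k V W" and ker: "\<And>v. v \<in> H \<Longrightarrow> h v = \<zero>\<^bsub>W\<^esub>"
  obtains g where "g \<in> lin_maps k (quot_mod V H) W"
    and "\<And>v. v \<in> carrier V \<Longrightarrow> g (H +>\<^bsub>V\<^esub> v) = h v"
proof
  interpret W: module k W by fact
  \<comment> \<open>The value on a coset is the sole element of its image under h; as a union of
    singletons over representatives it has the shape that \<open>coset_UN_eq\<close>
    evaluates.\<close>
  define g where "g = (\<lambda>X\<in>carrier (quot_mod V H). the_elem (\<Union>v\<in>X. {h v}))"
  show g: "g (H +>\<^bsub>V\<^esub> v) = h v" if v: "v \<in> carrier V" for v
  proof -
    have "(\<Union>u\<in>H +>\<^bsub>V\<^esub> v. {h u}) = {h v}"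
    proof (rule coset_UN_eq[OF v])
      fix u assume u: "u \<in> carrier V" "u \<ominus>\<^bsub>V\<^esub> v \<in> H"
      then have "h u \<ominus>\<^bsub>W\<^esub> h v = \<zero>\<^bsub>W\<^esub>"
        using ker by (simp flip: lin_maps_minus[OF V W h u(1) v])
      with u v show "{h u} = {h v}"
        by (simp add: W.minus_eq_zero_iff lin_maps_closed[OF h])
    qed
    with v show ?thesis by (simp add: g_def coset_in_quot_mod)
  qed
  show "g \<in> lin_maps k (quot_mod V H) W"
  proof (rule lin_mapsI)
    show "g \<in> carrier (quot_mod V H) \<rightarrow>\<^sub>E carrier W"
    proof (rule PiE_I)
      fix X assume "X \<in> carrier (quot_mod V H)"
      then show "g X \<in> carrier W"
        by (auto simp: carrier_quot_mod g lin_maps_closed[OF h])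
    qed (simp add: g_def)
  qed (auto simp: carrier_quot_mod coset_add coset_smult g lin_mapsD[OF h])
qed

end


section \<open>Limits and colimits\<close>

lemma
  assumes "is_rep k P M"
  shows is_rep_module: "a \<in> carrier P \<Longrightarrow> module k (Ob M a)"
    and is_rep_lin: "\<lbrakk>a \<in> carrier P; b \<in> carrier P; a \<sqsubseteq>\<^bsub>P\<^esub> b\<rbrakk> \<Longrightarrow> Mp M a b \<in> lin_maps k (Ob M a) (Ob M b)"
    and is_rep_id: "\<lbrakk>a \<in> carrier P; m \<in> carrier (Ob M a)\<rbrakk> \<Longrightarrow> Mp M a a m = m"
    and is_rep_comp: "\<lbrakk>a \<in> carrier P; b \<in> carrier P; c \<in> carrier P; a \<sqsubseteq>\<^bsub>P\<^esub> b; b \<sqsubseteq>\<^bsub>P\<^esub> c;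
      m \<in> carrier (Ob M a)\<rbrakk> \<Longrightarrow> Mp M b c (Mp M a b m) = Mp M a c m"
  using assms by (simp_all add: is_rep_def compose_def)

lemma is_rep_closed:
  assumes "is_rep k P M" "a \<in> carrier P" "b \<in> carrier P" "a \<sqsubseteq>\<^bsub>P\<^esub> b" "m \<in> carrier (Ob M a)"
  shows "Mp M a b m \<in> carrier (Ob M b)"
  using lin_maps_closed[OF is_rep_lin[OF assms(1-4)] assms(5)] .

text \<open>Later \<open>A\<close> is \<open>down P rho r a\<close> for colimits and
  \<open>up P rho r a\<close> for limits.\<close>

context
  fixes k :: "'k ring" and P :: "'p gorder" and M :: "('p, 'k, 'v) rep" and A :: "'p set"
  assumes k: "cring k" and M: "is_rep k P M" and A: "A \<subseteq> carrier P"
begin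

lemma module_Ob: "x \<in> A \<Longrightarrow> module k (Ob M x)"
  using is_rep_module[OF M] A by blast

lemma abelian_Ob: "x \<in> A \<Longrightarrow> abelian_group (Ob M x)"
  using module_Ob module.axioms(2) by blast

text \<open>The modules \<open>Ob M x\<close> vary with x, so no single locale interpretation covers
  them; their laws are collected here as rewrite rules conditional on
  \<open>x \<in> A\<close>.\<close>

lemmas Ob_simps =
  abelian_groupE(1,2)[OF abelian_Ob] abelian_monoid.l_zero[OF abelian_group.axioms(1)[OF abelian_Ob]]
  abelian_monoid.r_zero[OF abelian_group.axioms(1)[OF abelian_Ob]]
  abelian_group.a_inv_closed[OF abelian_Ob] abelian_group.l_neg[OF abelian_Ob]
  abelian_group.r_neg[OF abelian_Ob]
  module.smult_closed[OF module_Ob] module.smult_r_null[OF module_Ob] module.smult_l_null[OF module_Ob]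
  module.smult_l_distr[OF module_Ob] module.smult_r_distr[OF module_Ob]
  module.smult_assoc1[OF module_Ob] module.smult_one[OF module_Ob]

text \<open>Limits and direct sums share their pointwise operations and differ only in the carrier.\<close>

lemma module_families:
  assumes C: "C \<subseteq> (\<Pi>\<^sub>E x\<in>A. carrier (Ob M x))"
    and zero: "(\<lambda>x\<in>A. \<zero>\<^bsub>Ob M x\<^esub>) \<in> C"
    and add: "\<And>s t. \<lbrakk>s \<in> C; t \<in> C\<rbrakk> \<Longrightarrow> (\<lambda>x\<in>A. s x \<oplus>\<^bsub>Ob M x\<^esub> t x) \<in> C"
    and smult: "\<And>c s. \<lbrakk>c \<in> carrier k; s \<in> C\<rbrakk> \<Longrightarrow> (\<lambda>x\<in>A. c \<odot>\<^bsub>Ob M x\<^esub> s x) \<in> C"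
  shows "module k \<lparr>carrier = C, mult = undefined, one = undefined,
      zero = (\<lambda>x\<in>A. \<zero>\<^bsub>Ob M x\<^esub>), add = (\<lambda>s t. \<lambda>x\<in>A. s x \<oplus>\<^bsub>Ob M x\<^esub> t x),
      smult = (\<lambda>c s. \<lambda>x\<in>A. c \<odot>\<^bsub>Ob M x\<^esub> s x)\<rparr>"
proof -
  have mem: "s x \<in> carrier (Ob M x)" if "s \<in> C" "x \<in> A" for s x
    using C that by blast
  have ext: "(\<lambda>x\<in>A. s x) = s" if "s \<in> C" for s
    using C that by (auto simp: PiE_def extensional_restrict)
  have ext': "(\<lambda>x\<in>A. f x) = s" if "s \<in> C" "\<And>x. x \<in> A \<Longrightarrow> f x = s x" for f s
    using ext[OF that(1)] that(2) by (metis restrict_ext)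
  interpret k: cring k by (rule k)
  show ?thesis
  proof (rule moduleI)
    show "abelian_group \<lparr>carrier = C, mult = undefined, one = undefined,
      zero = (\<lambda>x\<in>A. \<zero>\<^bsub>Ob M x\<^esub>), add = (\<lambda>s t. \<lambda>x\<in>A. s x \<oplus>\<^bsub>Ob M x\<^esub> t x),
      smult = (\<lambda>c s. \<lambda>x\<in>A. c \<odot>\<^bsub>Ob M x\<^esub> s x)\<rparr>" (is "abelian_group ?F")
    proof (rule abelian_groupI)
      \<comment> \<open>The additive inverse is taken to be the multiple by -1, which lies in C by
        \<open>smult\<close>; pointwise negation then needs no closure assumption of its
        own.\<close>
      fix s assume s: "s \<in> carrier ?F"
      show "\<exists>t\<in>carrier ?F. t \<oplus>\<^bsub>?F\<^esub> s = \<zero>\<^bsub>?F\<^esub>"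
      proof
        show "((\<ominus>\<^bsub>k\<^esub> \<one>\<^bsub>k\<^esub>) \<odot>\<^bsub>?F\<^esub> s) \<oplus>\<^bsub>?F\<^esub> s = \<zero>\<^bsub>?F\<^esub>"
          using s by (auto simp: mem Ob_simps module.smult_l_minus[OF module_Ob] intro!: restrict_ext)
      qed (use s smult in auto)
    qed (auto simp: add zero mem Ob_simps abelian_groupE(3)[OF abelian_Ob] intro!: restrict_ext ext'
        intro: abelian_groupE(4)[OF abelian_Ob])
  qed (auto simp: k smult mem Ob_simps intro!: restrict_ext ext')
qed

section \<open>Limits as modules of compatible families\<close>

lemma limit_memD:
  assumes "s \<in> carrier (limit P A M)" "x \<in> A"
  shows "s x \<in> carrier (Ob M x)" "\<lbrakk>y \<in> A; x \<sqsubseteq>\<^bsub>P\<^esub> y\<rbrakk> \<Longrightarrow> Mp M x y (s x) = s y"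
  using assms by (auto simp: limit_def)

lemma limit_ext:
  assumes "s \<in> carrier (limit P A M)" "t \<in> carrier (limit P A M)" "\<And>x. x \<in> A \<Longrightarrow> s x = t x"
  shows "s = t"
  using assms by (auto simp: limit_def intro: PiE_ext)

lemma limit_memI:
  assumes "\<And>x. x \<in> A \<Longrightarrow> f x \<in> carrier (Ob M x)"
    and "\<And>x y. \<lbrakk>x \<in> A; y \<in> A; x \<sqsubseteq>\<^bsub>P\<^esub> y\<rbrakk> \<Longrightarrow> Mp M x y (f x) = f y"
  shows "(\<lambda>x\<in>A. f x) \<in> carrier (limit P A M)"
  using assms by (auto simp: limit_def)

lemma module_limit: "module k (limit P A M)"
  unfolding limit_def
proof (rule module_families)
  have lin: "Mp M x y \<in> lin_maps k (Ob M x) (Ob M y)" if "x \<in> A" "y \<in> A" "x \<sqsubseteq>\<^bsub>P\<^esub> y" for x y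
    using is_rep_lin[OF M] that A by blast
  let ?C = "{s \<in> (\<Pi>\<^sub>E x\<in>A. carrier (Ob M x)). \<forall>x\<in>A. \<forall>y\<in>A. x \<sqsubseteq>\<^bsub>P\<^esub> y \<longrightarrow> Mp M x y (s x) = s y}"
  show "(\<lambda>x\<in>A. \<zero>\<^bsub>Ob M x\<^esub>) \<in> ?C"
    by (auto simp: Ob_simps lin_maps_zero[OF module_Ob module_Ob lin])
  show "(\<lambda>x\<in>A. s x \<oplus>\<^bsub>Ob M x\<^esub> t x) \<in> ?C" if "s \<in> ?C" "t \<in> ?C" for s t
    using that by (auto simp: Ob_simps lin_maps_add[OF lin] PiE_iff)
  show "(\<lambda>x\<in>A. c \<odot>\<^bsub>Ob M x\<^esub> s x) \<in> ?C" if "c \<in> carrier k" "s \<in> ?C" for c s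
    using that by (auto simp: Ob_simps lin_maps_smult[OF lin] PiE_iff)
qed auto

section \<open>Direct sums: generation by the injections, and maps out of them\<close>

lemma dir_sum_ops:
  "\<zero>\<^bsub>dir_sum A M\<^esub> = (\<lambda>x\<in>A. \<zero>\<^bsub>Ob M x\<^esub>)"
  "s \<oplus>\<^bsub>dir_sum A M\<^esub> t = (\<lambda>x\<in>A. s x \<oplus>\<^bsub>Ob M x\<^esub> t x)"
  "c \<odot>\<^bsub>dir_sum A M\<^esub> s = (\<lambda>x\<in>A. c \<odot>\<^bsub>Ob M x\<^esub> s x)"
  by (simp_all add: dir_sum_def)

lemma dir_sum_memD:
  assumes "s \<in> carrier (dir_sum A M)"
  shows "x \<in> A \<Longrightarrow> s x \<in> carrier (Ob M x)" "finite {x \<in> A. s x \<noteq> \<zero>\<^bsub>Ob M x\<^esub>}"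
  using assms by (auto simp: dir_sum_def)

lemma dir_sum_memI:
  assumes "\<And>x. x \<in> A \<Longrightarrow> f x \<in> carrier (Ob M x)"
    and "finite F" "\<And>x. \<lbrakk>x \<in> A; x \<notin> F\<rbrakk> \<Longrightarrow> f x = \<zero>\<^bsub>Ob M x\<^esub>"
  shows "(\<lambda>x\<in>A. f x) \<in> carrier (dir_sum A M)"
proof -
  have "{x \<in> A. (\<lambda>x\<in>A. f x) x \<noteq> \<zero>\<^bsub>Ob M x\<^esub>} \<subseteq> F" using assms(3) by auto
  then have "finite {x \<in> A. (\<lambda>x\<in>A. f x) x \<noteq> \<zero>\<^bsub>Ob M x\<^esub>}" using assms(2) finite_subset by blast
  with assms(1) show ?thesis by (simp add: dir_sum_def)
qed

lemma dir_sum_ext: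
  assumes "s \<in> carrier (dir_sum A M)" "t \<in> carrier (dir_sum A M)" "\<And>x. x \<in> A \<Longrightarrow> s x = t x"
  shows "s = t"
  using assms by (auto simp: dir_sum_def intro: PiE_ext)

lemma module_dir_sum: "module k (dir_sum A M)"
  unfolding dir_sum_def
proof (rule module_families)
  let ?S = "\<lambda>s. {x \<in> A. s x \<noteq> \<zero>\<^bsub>Ob M x\<^esub>}"
  let ?C = "{s \<in> (\<Pi>\<^sub>E x\<in>A. carrier (Ob M x)). finite (?S s)}"
  show "(\<lambda>x\<in>A. \<zero>\<^bsub>Ob M x\<^esub>) \<in> ?C"
    by (auto simp: Ob_simps)
  show "(\<lambda>x\<in>A. s x \<oplus>\<^bsub>Ob M x\<^esub> t x) \<in> ?C" if "s \<in> ?C" "t \<in> ?C" for s t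
    using that
    by (auto simp: Ob_simps PiE_iff intro: finite_subset[where B = "?S s \<union> ?S t"])
  show "(\<lambda>x\<in>A. c \<odot>\<^bsub>Ob M x\<^esub> s x) \<in> ?C" if "c \<in> carrier k" "s \<in> ?C" for c s
    using that by (auto simp: Ob_simps PiE_iff intro: finite_subset[where B = "?S s"])
qed auto

lemma dir_inj_apply: "y \<in> A \<Longrightarrow> dir_inj A M x m y = (if y = x then m else \<zero>\<^bsub>Ob M y\<^esub>)"
  by (simp add: dir_inj_def)

lemma dir_inj_closed:
  "\<lbrakk>x \<in> A; m \<in> carrier (Ob M x)\<rbrakk> \<Longrightarrow> dir_inj A M x m \<in> carrier (dir_sum A M)"
  unfolding dir_inj_def by (rule dir_sum_memI[where F = "{x}"]) (auto simp: Ob_simps)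

lemma dir_inj_add:
  "\<lbrakk>x \<in> A; m \<in> carrier (Ob M x); n \<in> carrier (Ob M x)\<rbrakk>
    \<Longrightarrow> dir_inj A M x (m \<oplus>\<^bsub>Ob M x\<^esub> n) = dir_inj A M x m \<oplus>\<^bsub>dir_sum A M\<^esub> dir_inj A M x n"
  by (auto simp: dir_inj_def dir_sum_ops Ob_simps intro!: restrict_ext)

lemma dir_inj_smult:
  "\<lbrakk>x \<in> A; c \<in> carrier k; m \<in> carrier (Ob M x)\<rbrakk>
    \<Longrightarrow> dir_inj A M x (c \<odot>\<^bsub>Ob M x\<^esub> m) = c \<odot>\<^bsub>dir_sum A M\<^esub> dir_inj A M x m"
  by (auto simp: dir_inj_def dir_sum_ops Ob_simps intro!: restrict_ext)

text \<open>A finitely supported family is built from zero by adding one entry at a time. This is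
  what later reduces statements about colimits to their canonical maps.\<close>

lemma dir_sum_induct:
  assumes s: "s \<in> carrier (dir_sum A M)"
    and zero: "Q \<zero>\<^bsub>dir_sum A M\<^esub>"
    and step: "\<And>t x m. \<lbrakk>t \<in> carrier (dir_sum A M); x \<in> A; m \<in> carrier (Ob M x); Q t\<rbrakk>
      \<Longrightarrow> Q (dir_inj A M x m \<oplus>\<^bsub>dir_sum A M\<^esub> t)"
  shows "Q s"
proof -
  \<comment> \<open>The induction runs over a finite set that contains the support instead of the
    support itself, so the entry that is split off may also be zero.\<close>
  have "\<forall>s\<in>carrier (dir_sum A M). {x \<in> A. s x \<noteq> \<zero>\<^bsub>Ob M x\<^esub>} \<subseteq> F \<longrightarrow> Q s" if "finite F" for F
    using that
  proof induction
    case empty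
    have "s = \<zero>\<^bsub>dir_sum A M\<^esub>"
      if "s \<in> carrier (dir_sum A M)" "{x \<in> A. s x \<noteq> \<zero>\<^bsub>Ob M x\<^esub>} \<subseteq> {}" for s
    proof (rule dir_sum_ext[OF that(1)])
      show "\<zero>\<^bsub>dir_sum A M\<^esub> \<in> carrier (dir_sum A M)"
        using module_dir_sum by (metis abelian_groupE(2) module.axioms(2))
    qed (use that(2) in \<open>auto simp: dir_sum_ops\<close>)
    with zero show ?case by blast
  next
    case (insert z F)
    show ?case
    proof (intro ballI impI)
      fix s assume s: "s \<in> carrier (dir_sum A M)" "{x \<in> A. s x \<noteq> \<zero>\<^bsub>Ob M x\<^esub>} \<subseteq> insert z F"
      show "Q s"
      proof (cases "z \<in> A")
        case False
        \<comment> \<open>The support lies in A, so an index outside A adds nothing to the bound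
          F.\<close>
        with s insert.IH show ?thesis by blast
      next
        case True
        \<comment> \<open>The family s with its entry at z erased, so that s is the injection of
          \<open>s z\<close> plus t.\<close>
        define t where "t = (\<lambda>x\<in>A. if x = z then \<zero>\<^bsub>Ob M x\<^esub> else s x)"
        have t: "t \<in> carrier (dir_sum A M)"
          unfolding t_def using insert.hyps(1) s
          by (intro dir_sum_memI[where F = F]) (auto simp: Ob_simps dir_sum_memD)
        moreover have "{x \<in> A. t x \<noteq> \<zero>\<^bsub>Ob M x\<^esub>} \<subseteq> F"
          using s(2) by (auto simp: t_def)
        ultimately have "Q t" using insert.IH by blast
        then have "Q (dir_inj A M z (s z) \<oplus>\<^bsub>dir_sum A M\<^esub> t)"
          using step[OF t True] s(1) True by (simp add: dir_sum_memD)
        also have "dir_inj A M z (s z) \<oplus>\<^bsub>dir_sum A M\<^esub> t = (\<lambda>x\<in>A. s x)"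
          using s(1) by (auto simp: dir_sum_ops dir_inj_apply t_def Ob_simps dir_sum_memD
              intro!: restrict_ext)
        also have "\<dots> = s"
          using s(1) by (auto simp: dir_sum_def)
        finally show ?thesis .
      qed
    qed
  qed
  from this[OF dir_sum_memD(2)[OF s]] s show ?thesis by blast
qed

text \<open>The map is h(s) = sum of f x (s x) over the support of s, which is finite. Supports
  change under addition and scaling, so linearity is checked after enlarging the index set.\<close>

lemma dir_sum_desc:
  assumes W: "module k W" and f: "\<And>x. x \<in> A \<Longrightarrow> f x \<in> lin_maps k (Ob M x) W"
  obtains h where "h \<in> lin_maps k (dir_sum A M) W"
    and "\<And>x m. \<lbrakk>x \<in> A; m \<in> carrier (Ob M x)\<rbrakk> \<Longrightarrow> h (dir_inj A M x m) = f x m"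
proof
  interpret W: module k W by fact
  define S where "S s = {x \<in> A. s x \<noteq> \<zero>\<^bsub>Ob M x\<^esub>}" for s
  define h where "h = (\<lambda>s\<in>carrier (dir_sum A M). \<Oplus>\<^bsub>W\<^esub>x\<in>S s. f x (s x))"
  have fin: "finite (S s)" if "s \<in> carrier (dir_sum A M)" for s
    using dir_sum_memD(2)[OF that] by (simp add: S_def)
  have S: "S s \<subseteq> A" for s by (auto simp: S_def)
  have fs: "f x (s x) \<in> carrier W" if "s \<in> carrier (dir_sum A M)" "x \<in> A" for s x
    using that by (auto intro: lin_maps_closed[OF f] dir_sum_memD)
  have f0: "f x \<zero>\<^bsub>Ob M x\<^esub> = \<zero>\<^bsub>W\<^esub>" if "x \<in> A" for x
    using lin_maps_zero[OF module_Ob W f] that by blast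
  \<comment> \<open>Since each f x sends zero to zero, the support may be replaced by any finite
    subset of A that contains it.\<close>
  have h: "h s = (\<Oplus>\<^bsub>W\<^esub>x\<in>F. f x (s x))"
    if s: "s \<in> carrier (dir_sum A M)" and F: "finite F" "S s \<subseteq> F" "F \<subseteq> A" for s F
  proof -
    have "(\<Oplus>\<^bsub>W\<^esub>x\<in>S s. f x (s x)) = (\<Oplus>\<^bsub>W\<^esub>x\<in>F. f x (s x))"
      by (rule W.M.add.finprod_mono_neutral_cong_left)
        (use F s fs f0 S in \<open>auto simp: S_def subset_eq\<close>)
    with s show ?thesis by (simp add: h_def)
  qed
  interpret D: module k "dir_sum A M" by (rule module_dir_sum)
  show "h \<in> lin_maps k (dir_sum A M) W"
  proof (rule lin_mapsI)
    show "h \<in> carrier (dir_sum A M) \<rightarrow>\<^sub>E carrier W"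
      using S fs by (auto simp: h_def intro!: W.M.finsum_closed)
  next
    fix s t assume s: "s \<in> carrier (dir_sum A M)" and t: "t \<in> carrier (dir_sum A M)"
    \<comment> \<open>A common index set for s, t and their sum, whose support may be smaller
      because of cancellation.\<close>
    let ?F = "S s \<union> S t"
    have F: "finite ?F" "?F \<subseteq> A" using s t fin S by auto
    have "S (s \<oplus>\<^bsub>dir_sum A M\<^esub> t) \<subseteq> ?F"
      by (auto simp: S_def dir_sum_ops Ob_simps)
    then have "h (s \<oplus>\<^bsub>dir_sum A M\<^esub> t) = (\<Oplus>\<^bsub>W\<^esub>x\<in>?F. f x ((s \<oplus>\<^bsub>dir_sum A M\<^esub> t) x))"
      using s t F by (intro h) auto
    also have "\<dots> = (\<Oplus>\<^bsub>W\<^esub>x\<in>?F. f x (s x) \<oplus>\<^bsub>W\<^esub> f x (t x))"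
      by (rule W.M.finsum_cong')
        (use s t F fs in \<open>auto simp: dir_sum_ops subset_eq dir_sum_memD lin_maps_add[OF f]\<close>)
    also have "\<dots> = (\<Oplus>\<^bsub>W\<^esub>x\<in>?F. f x (s x)) \<oplus>\<^bsub>W\<^esub> (\<Oplus>\<^bsub>W\<^esub>x\<in>?F. f x (t x))"
      by (rule W.M.finsum_addf) (use s t F fs in auto)
    also have "\<dots> = h s \<oplus>\<^bsub>W\<^esub> h t"
      using h[OF s F(1) _ F(2)] h[OF t F(1) _ F(2)] by simp
    finally show "h (s \<oplus>\<^bsub>dir_sum A M\<^esub> t) = h s \<oplus>\<^bsub>W\<^esub> h t" .
  next
    fix c s assume c: "c \<in> carrier k" and s: "s \<in> carrier (dir_sum A M)"
    have "S (c \<odot>\<^bsub>dir_sum A M\<^esub> s) \<subseteq> S s"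
      using c by (auto simp: S_def dir_sum_ops Ob_simps)
    then have "h (c \<odot>\<^bsub>dir_sum A M\<^esub> s) = (\<Oplus>\<^bsub>W\<^esub>x\<in>S s. f x ((c \<odot>\<^bsub>dir_sum A M\<^esub> s) x))"
      using c s S fin by (intro h) auto
    also have "\<dots> = (\<Oplus>\<^bsub>W\<^esub>x\<in>S s. c \<odot>\<^bsub>W\<^esub> f x (s x))"
      by (rule W.M.finsum_cong')
        (use c s fs in \<open>auto simp: S_def dir_sum_ops dir_sum_memD lin_maps_smult[OF f]\<close>)
    also have "\<dots> = c \<odot>\<^bsub>W\<^esub> h s"
      using c s fs fin S by (subst W.finsum_smult_ldistr[symmetric]) (auto simp: h_def subset_eq)
    finally show "h (c \<odot>\<^bsub>dir_sum A M\<^esub> s) = c \<odot>\<^bsub>W\<^esub> h s" .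
  qed
  show "h (dir_inj A M x m) = f x m" if "x \<in> A" "m \<in> carrier (Ob M x)" for x m
  proof -
    \<comment> \<open>The sum is taken over {x} and not over the support, which is empty when m is
      zero.\<close>
    have "h (dir_inj A M x m) = (\<Oplus>\<^bsub>W\<^esub>y\<in>{x}. f y (dir_inj A M x m y))"
      by (rule h) (use that in \<open>auto simp: S_def dir_inj_apply dir_inj_closed split: if_splits\<close>)
    also have "\<dots> = f x m"
      using that lin_maps_closed[OF f] by (simp add: dir_inj_apply)
    finally show ?thesis .
  qed
qed

section \<open>Colimits and their universal property\<close>

lemma submodule_colim_rel: "submodule (colim_rel k P A M) k (dir_sum A M)"
proof -
  interpret D: module k "dir_sum A M" by (rule module_dir_sum)
  \<comment> \<open>The whole direct sum is one of the submodules that are intersected; an empty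
    intersection would be the universe of the type and not lie in the carrier.\<close>
  have "carrier (dir_sum A M) \<in> {H. submodule H k (dir_sum A M) \<and>
     (\<forall>x\<in>A. \<forall>y\<in>A. x \<sqsubseteq>\<^bsub>P\<^esub> y \<longrightarrow> (\<forall>m\<in>carrier (Ob M x).
        dir_inj A M x m \<ominus>\<^bsub>dir_sum A M\<^esub> dir_inj A M y (Mp M x y m) \<in> H))}"
    using D.carrier_is_submodule A
    by (auto intro!: D.M.minus_closed dir_inj_closed is_rep_closed[OF M])
  then have sub: "colim_rel k P A M \<subseteq> carrier (dir_sum A M)"
    unfolding colim_rel_def by blast
  show ?thesis
  proof (rule D.submoduleI_smult[OF sub])
  qed (use D.submoduleE submodule_zero in \<open>auto simp: colim_rel_def\<close>)
qed

lemma colim_rel_gen: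
  assumes "x \<in> A" "y \<in> A" "x \<sqsubseteq>\<^bsub>P\<^esub> y" "m \<in> carrier (Ob M x)"
  shows "dir_inj A M x m \<ominus>\<^bsub>dir_sum A M\<^esub> dir_inj A M y (Mp M x y m) \<in> colim_rel k P A M"
  using assms by (auto simp: colim_rel_def)

lemma module_colim: "module k (colim k P A M)"
  unfolding colim_def by (intro module_quot_mod module_dir_sum submodule_colim_rel)

lemmas colim_coset_add = coset_add[OF module_dir_sum submodule_colim_rel, folded colim_def]
lemmas colim_coset_smult = coset_smult[OF module_dir_sum submodule_colim_rel, folded colim_def]
lemmas colim_coset_closed = coset_in_quot_mod[OF module_dir_sum submodule_colim_rel, folded colim_def]

lemma colim_in_lin:
  assumes "x \<in> A"
  shows "colim_in k P A M x \<in> lin_maps k (Ob M x) (colim k P A M)"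
  unfolding colim_in_def
  by (rule lin_mapsI)
    (use assms in \<open>auto simp: colim_coset_add colim_coset_smult colim_coset_closed dir_inj_closed
      dir_inj_add dir_inj_smult Ob_simps\<close>)

lemma colim_in_natural:
  assumes "x \<in> A" "y \<in> A" "x \<sqsubseteq>\<^bsub>P\<^esub> y" "m \<in> carrier (Ob M x)"
  shows "colim_in k P A M y (Mp M x y m) = colim_in k P A M x m"
proof -
  have c: "Mp M x y m \<in> carrier (Ob M y)"
    using is_rep_closed[OF M] assms A by blast
  have "colim_rel k P A M +>\<^bsub>dir_sum A M\<^esub> dir_inj A M x m
      = colim_rel k P A M +>\<^bsub>dir_sum A M\<^esub> dir_inj A M y (Mp M x y m)"
    using assms c colim_rel_gen[OF assms]
    by (simp add: coset_eq_iff[OF module_dir_sum submodule_colim_rel] dir_inj_closed)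
  with assms c show ?thesis by (simp add: colim_in_def)
qed

text \<open>Every class has a representative in the direct sum, and \<open>dir_sum_induct\<close>
  reduces that representative to injections, whose classes are the values of
  \<open>colim_in\<close>.\<close>

lemma colim_ext:
  assumes g: "g \<in> lin_maps k (colim k P A M) W" and h: "h \<in> lin_maps k (colim k P A M) W"
    and W: "module k W"
    and eq: "\<And>x m. \<lbrakk>x \<in> A; m \<in> carrier (Ob M x)\<rbrakk>
      \<Longrightarrow> g (colim_in k P A M x m) = h (colim_in k P A M x m)"
  shows "g = h"
proof (rule lin_maps_eqI[OF g h])
  interpret D: module k "dir_sum A M" by (rule module_dir_sum)
  let ?q = "\<lambda>s. colim_rel k P A M +>\<^bsub>dir_sum A M\<^esub> s"
  fix v assume "v \<in> carrier (colim k P A M)"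
  then obtain s where s: "s \<in> carrier (dir_sum A M)" "v = ?q s"
    by (auto simp: colim_def carrier_quot_mod[OF module_dir_sum submodule_colim_rel])
  have "g (?q s) = h (?q s)"
    using s(1)
  proof (rule dir_sum_induct)
    have "?q \<zero>\<^bsub>dir_sum A M\<^esub> = \<zero>\<^bsub>colim k P A M\<^esub>"
      by (simp add: colim_def zero_quot_mod[OF module_dir_sum submodule_colim_rel])
    then show "g (?q \<zero>\<^bsub>dir_sum A M\<^esub>) = h (?q \<zero>\<^bsub>dir_sum A M\<^esub>)"
      by (simp add: lin_maps_zero[OF module_colim W g] lin_maps_zero[OF module_colim W h])
  next
    fix t x m
    assume t: "t \<in> carrier (dir_sum A M)" and x: "x \<in> A" "m \<in> carrier (Ob M x)"
      and IH: "g (?q t) = h (?q t)"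
    then have "g (?q (dir_inj A M x m)) = h (?q (dir_inj A M x m))"
      using eq[of x m] by (simp add: colim_in_def)
    with t x IH show "g (?q (dir_inj A M x m \<oplus>\<^bsub>dir_sum A M\<^esub> t)) = h (?q (dir_inj A M x m \<oplus>\<^bsub>dir_sum A M\<^esub> t))"
      by (simp add: colim_coset_closed dir_inj_closed lin_maps_add[OF g] lin_maps_add[OF h]
          flip: colim_coset_add)
  qed
  with s show "g v = h v" by simp
qed

text \<open>The cocone gives a map on the direct sum, which descends to the colimit;
  \<open>colim_ext\<close> makes the result unique, so the description in \<open>colim_desc\<close>
  is met by exactly this map. The cocone equations hold as equations of functions because both sides
  are extensional on \<open>Ob M x\<close>.\<close>

lemma
  assumes W: "module k W" and f: "\<And>x. x \<in> A \<Longrightarrow> f x \<in> lin_maps k (Ob M x) W"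
    and cocone: "\<And>x y m. \<lbrakk>x \<in> A; y \<in> A; x \<sqsubseteq>\<^bsub>P\<^esub> y; m \<in> carrier (Ob M x)\<rbrakk>
      \<Longrightarrow> f y (Mp M x y m) = f x m"
  shows colim_desc_lin: "colim_desc k P A M W f \<in> lin_maps k (colim k P A M) W"
    and colim_desc_in: "\<lbrakk>x \<in> A; m \<in> carrier (Ob M x)\<rbrakk>
      \<Longrightarrow> colim_desc k P A M W f (colim_in k P A M x m) = f x m"
proof -
  interpret W: module k W by fact
  obtain h where h: "h \<in> lin_maps k (dir_sum A M) W"
    and hin: "\<And>x m. \<lbrakk>x \<in> A; m \<in> carrier (Ob M x)\<rbrakk> \<Longrightarrow> h (dir_inj A M x m) = f x m"
    using dir_sum_desc[OF W f] by blast
  have "h (dir_inj A M x m \<ominus>\<^bsub>dir_sum A M\<^esub> dir_inj A M y (Mp M x y m)) = \<zero>\<^bsub>W\<^esub>"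
    and "dir_inj A M x m \<ominus>\<^bsub>dir_sum A M\<^esub> dir_inj A M y (Mp M x y m) \<in> carrier (dir_sum A M)"
    if "x \<in> A" "y \<in> A" "x \<sqsubseteq>\<^bsub>P\<^esub> y" "m \<in> carrier (Ob M x)" for x y m
  proof -
    interpret D: module k "dir_sum A M" by (rule module_dir_sum)
    have c: "Mp M x y m \<in> carrier (Ob M y)"
      using is_rep_closed[OF M] that A by blast
    show "h (dir_inj A M x m \<ominus>\<^bsub>dir_sum A M\<^esub> dir_inj A M y (Mp M x y m)) = \<zero>\<^bsub>W\<^esub>"
      using that c cocone[OF that]
      by (simp add: lin_maps_minus[OF module_dir_sum W h] dir_inj_closed hin W.minus_eq_zero_iff
          lin_maps_closed[OF f])
    show "dir_inj A M x m \<ominus>\<^bsub>dir_sum A M\<^esub> dir_inj A M y (Mp M x y m) \<in> carrier (dir_sum A M)"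
      using that c by (simp add: dir_inj_closed)
  qed
  \<comment> \<open>The cocone condition says that the kernel of h contains all generating
    relations, so this kernel is one of the submodules whose intersection is
    \<open>colim_rel\<close>.\<close>
  then have "colim_rel k P A M \<subseteq> a_kernel (dir_sum A M) W h"
    unfolding colim_rel_def
    by (intro Inter_lower) (simp add: submodule_kernel[OF module_dir_sum W h] a_kernel_iff)
  then obtain g where g: "g \<in> lin_maps k (colim k P A M) W"
    and gq: "\<And>s. s \<in> carrier (dir_sum A M) \<Longrightarrow> g (colim_rel k P A M +>\<^bsub>dir_sum A M\<^esub> s) = h s"
    using quot_mod_factor[OF module_dir_sum submodule_colim_rel W h]
    unfolding colim_def a_kernel_iff subset_eq by blast
  have gin: "g (colim_in k P A M x m) = f x m" if "x \<in> A" "m \<in> carrier (Ob M x)" for x m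
    using that by (simp add: colim_in_def gq dir_inj_closed hin)
  have "colim_desc k P A M W f = g"
    unfolding colim_desc_def
  proof (rule the_equality)
    show "g \<in> lin_maps k (colim k P A M) W \<and>
      (\<forall>x\<in>A. compose (carrier (Ob M x)) g (colim_in k P A M x) = f x)"
      using g gin lin_maps_extensional[OF f]
      by (auto simp: compose_def intro!: extensionalityI[of _ "carrier (Ob M _)"])
  next
    fix h assume *: "h \<in> lin_maps k (colim k P A M) W \<and>
      (\<forall>x\<in>A. compose (carrier (Ob M x)) h (colim_in k P A M x) = f x)"
    have "h (colim_in k P A M x m) = f x m" if "x \<in> A" "m \<in> carrier (Ob M x)" for x m
      using * that by (metis compose_eq)
    with * g gin W show "h = g" by (intro colim_ext[where W = W]) auto
  qed
  with g gin show "colim_desc k P A M W f \<in> lin_maps k (colim k P A M) W"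
    and "\<lbrakk>x \<in> A; m \<in> carrier (Ob M x)\<rbrakk> \<Longrightarrow> colim_desc k P A M W f (colim_in k P A M x m) = f x m"
    by auto
qed

end


section \<open>Morphisms, subrepresentations and quotients\<close>

lemma rep_homI:
  assumes "f \<in> extensional (carrier P)"
    and "\<And>a. a \<in> carrier P \<Longrightarrow> f a \<in> lin_maps k (Ob M a) (Ob N a)"
    and "\<And>a b m. \<lbrakk>a \<in> carrier P; b \<in> carrier P; a \<sqsubseteq>\<^bsub>P\<^esub> b; m \<in> carrier (Ob M a)\<rbrakk>
      \<Longrightarrow> Mp N a b (f a m) = f b (Mp M a b m)"
  shows "f \<in> rep_hom k P M N"
  using assms by (auto simp: rep_hom_def PiE_def compose_def intro!: restrict_ext)

lemma
  assumes "f \<in> rep_hom k P M N"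
  shows rep_hom_lin: "a \<in> carrier P \<Longrightarrow> f a \<in> lin_maps k (Ob M a) (Ob N a)"
    and rep_hom_natural: "\<lbrakk>a \<in> carrier P; b \<in> carrier P; a \<sqsubseteq>\<^bsub>P\<^esub> b; m \<in> carrier (Ob M a)\<rbrakk>
      \<Longrightarrow> Mp N a b (f a m) = f b (Mp M a b m)"
    and rep_hom_extensional: "f \<in> extensional (carrier P)"
proof -
  show "Mp N a b (f a m) = f b (Mp M a b m)"
    if "a \<in> carrier P" "b \<in> carrier P" "a \<sqsubseteq>\<^bsub>P\<^esub> b" "m \<in> carrier (Ob M a)"
  proof -
    have "compose (carrier (Ob M a)) (Mp N a b) (f a) = compose (carrier (Ob M a)) (f b) (Mp M a b)"
      using assms that by (simp add: rep_hom_def)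
    with that show ?thesis by (metis compose_eq)
  qed
qed (use assms in \<open>auto simp: rep_hom_def PiE_def\<close>)

lemma rep_hom_closed:
  assumes "f \<in> rep_hom k P M N" "a \<in> carrier P" "m \<in> carrier (Ob M a)"
  shows "f a m \<in> carrier (Ob N a)"
  using lin_maps_closed[OF rep_hom_lin[OF assms(1,2)] assms(3)] .

section \<open>Subrepresentations, images and kernels\<close>

lemma Ob_sub_rep: "Ob (sub_rep M S) a = (Ob M a)\<lparr>carrier := S a\<rparr>"
  by (simp add: sub_rep_def)

lemma Mp_sub_rep: "m \<in> S a \<Longrightarrow> Mp (sub_rep M S) a b m = Mp M a b m"
  by (simp add: sub_rep_def)

lemma is_subrepD:
  assumes "is_subrep k P S M"
  shows "a \<in> carrier P \<Longrightarrow> submodule (S a) k (Ob M a)"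
    and "\<lbrakk>a \<in> carrier P; b \<in> carrier P; a \<sqsubseteq>\<^bsub>P\<^esub> b; m \<in> S a\<rbrakk> \<Longrightarrow> Mp M a b m \<in> S b"
  using assms unfolding is_subrep_def by blast+

lemma is_subrep_subset: "\<lbrakk>is_subrep k P S M; a \<in> carrier P\<rbrakk> \<Longrightarrow> S a \<subseteq> carrier (Ob M a)"
  using subgroup.subset[OF submodule.axioms(1)[OF is_subrepD(1), of k P S M a]] by simp

lemma lin_maps_restrict_submodule:
  assumes "h \<in> lin_maps k V W" "module k V" "submodule S k V" "h ` S \<subseteq> T"
  shows "restrict h S \<in> lin_maps k (V\<lparr>carrier := S\<rparr>) (W\<lparr>carrier := T\<rparr>)"
proof -
  interpret V: module k V by fact
  have S: "S \<subseteq> carrier V" by (rule V.submoduleE[OF assms(3)])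
  show ?thesis
  proof (rule lin_mapsI)
    show "restrict h S \<in> carrier (V\<lparr>carrier := S\<rparr>) \<rightarrow>\<^sub>E carrier (W\<lparr>carrier := T\<rparr>)"
      using assms(4) by auto
  qed (use S V.submoduleE(4,5)[OF assms(3)] in \<open>auto simp: subset_eq lin_mapsD[OF assms(1)]\<close>)
qed

lemma is_rep_sub_rep:
  assumes M: "is_rep k P M" and S: "is_subrep k P S M"
  shows "is_rep k P (sub_rep M S)"
  unfolding is_rep_def
proof (intro conjI ballI impI)
  fix a assume a: "a \<in> carrier P"
  show "module k (Ob (sub_rep M S) a)"
    unfolding Ob_sub_rep
    by (rule submodule.submodule_is_module[OF is_subrepD(1)[OF S a] is_rep_module[OF M a]])
  have sub: "m \<in> carrier (Ob M a)" if "m \<in> S a" for m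
    using is_subrep_subset[OF S a] that by blast
  show "Mp (sub_rep M S) a a = (\<lambda>m\<in>carrier (Ob (sub_rep M S) a). m)"
    using a by (auto simp: sub_rep_def is_rep_id[OF M] sub intro!: restrict_ext)
  fix b assume b: "b \<in> carrier P"
  show "Mp (sub_rep M S) a b \<in> lin_maps k (Ob (sub_rep M S) a) (Ob (sub_rep M S) b)"
    if ab: "a \<sqsubseteq>\<^bsub>P\<^esub> b"
  proof -
    have "restrict (Mp M a b) (S a) \<in> lin_maps k (Ob M a\<lparr>carrier := S a\<rparr>) (Ob M b\<lparr>carrier := S b\<rparr>)"
      by (rule lin_maps_restrict_submodule[OF is_rep_lin[OF M a b ab] is_rep_module[OF M a]
            is_subrepD(1)[OF S a]]) (use is_subrepD(2)[OF S a b ab] in auto)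
    then show ?thesis by (simp add: sub_rep_def)
  qed
  fix c assume c: "c \<in> carrier P" and le: "a \<sqsubseteq>\<^bsub>P\<^esub> b" "b \<sqsubseteq>\<^bsub>P\<^esub> c"
  show "Mp (sub_rep M S) a c
    = compose (carrier (Ob (sub_rep M S) a)) (Mp (sub_rep M S) b c) (Mp (sub_rep M S) a b)"
    using a b c le is_subrepD(2)[OF S a b le(1)]
    by (auto simp: sub_rep_def compose_def sub is_rep_comp[OF M] intro!: restrict_ext)
qed

lemma is_subrep_im_fam:
  assumes M: "is_rep k P M" and N: "is_rep k P N" and f: "f \<in> rep_hom k P M N"
  shows "is_subrep k P (im_fam M f) N"
  unfolding is_subrep_def im_fam_def
proof (intro conjI ballI impI)
  fix a assume a: "a \<in> carrier P"
  show "submodule (f a ` carrier (Ob M a)) k (Ob N a)"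
    by (rule submodule_image[OF is_rep_module[OF M a] is_rep_module[OF N a] rep_hom_lin[OF f a]])
  fix b assume "b \<in> carrier P" "a \<sqsubseteq>\<^bsub>P\<^esub> b"
  then show "Mp N a b ` f a ` carrier (Ob M a) \<subseteq> f b ` carrier (Ob M b)"
    using a by (auto simp: rep_hom_natural[OF f] intro!: imageI is_rep_closed[OF M])
qed

lemma is_subrep_ker_fam:
  assumes M: "is_rep k P M" and N: "is_rep k P N" and f: "f \<in> rep_hom k P M N"
  shows "is_subrep k P (ker_fam M N f) M"
  unfolding is_subrep_def ker_fam_def
proof (intro conjI ballI impI)
  fix a assume a: "a \<in> carrier P"
  show "submodule (a_kernel (Ob M a) (Ob N a) (f a)) k (Ob M a)"
    by (rule submodule_kernel[OF is_rep_module[OF M a] is_rep_module[OF N a] rep_hom_lin[OF f a]])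
  fix b assume b: "b \<in> carrier P" "a \<sqsubseteq>\<^bsub>P\<^esub> b"
  have "Mp N a b \<zero>\<^bsub>Ob N a\<^esub> = \<zero>\<^bsub>Ob N b\<^esub>"
    using a b by (intro lin_maps_zero[OF is_rep_module[OF N] is_rep_module[OF N] is_rep_lin[OF N]])
  then show "Mp M a b ` a_kernel (Ob M a) (Ob N a) (f a) \<subseteq> a_kernel (Ob M b) (Ob N b) (f b)"
    using a b by (auto simp: a_kernel_iff is_rep_closed[OF M] simp flip: rep_hom_natural[OF f])
qed

lemma is_subrep_inter:
  assumes "is_rep k P M" "is_subrep k P S M" "is_subrep k P T M"
  shows "is_subrep k P (\<lambda>a. S a \<inter> T a) M"
  unfolding is_subrep_def
proof (intro conjI ballI impI)
  show "submodule (S a \<inter> T a) k (Ob M a)" if "a \<in> carrier P" for a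
    using that by (intro submodule_inter is_rep_module[OF assms(1)] is_subrepD(1)[OF assms(2)]
        is_subrepD(1)[OF assms(3)])
qed (use is_subrepD(2)[OF assms(2)] is_subrepD(2)[OF assms(3)] in blast)

text \<open>In \<open>EN\<close> both \<open>M1\<close> and \<open>M2\<close> are given inside M,
  while the quotient is formed from \<open>sub_rep M M1\<close>; this lemma moves \<open>M2\<close>
  there.\<close>

lemma is_subrep_sub_rep:
  assumes M: "is_rep k P M" and S: "is_subrep k P S M" and K: "is_subrep k P K M"
    and sub: "\<And>a. a \<in> carrier P \<Longrightarrow> K a \<subseteq> S a"
  shows "is_subrep k P K (sub_rep M S)"
  unfolding is_subrep_def Ob_sub_rep
proof (intro conjI ballI impI)
  fix a assume a: "a \<in> carrier P"
  show "submodule (K a) k (Ob M a\<lparr>carrier := S a\<rparr>)"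
    using a by (intro submodule_restrict_carrier is_rep_module[OF M] is_subrepD(1)[OF S]
        is_subrepD(1)[OF K] sub)
  fix b assume "b \<in> carrier P" "a \<sqsubseteq>\<^bsub>P\<^esub> b"
  then show "Mp (sub_rep M S) a b ` K a \<subseteq> K b"
    using a sub[OF a] is_subrepD(2)[OF K] by (auto simp: sub_rep_def subset_eq)
qed

text \<open>Every element of the target has the form f m, and the pointwise inverse returns m there;
  its linearity and naturality are thus read off from those of f.\<close>

lemma rep_iso_bij:
  assumes M: "is_rep k P M" and f: "f \<in> rep_hom k P M N"
    and mod: "\<And>a. a \<in> carrier P \<Longrightarrow> module k (Ob N a)"
    and bij: "\<And>a. a \<in> carrier P \<Longrightarrow> bij_betw (f a) (carrier (Ob M a)) (carrier (Ob N a))"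
  shows "rep_iso k P M N"
proof -
  define g where "g = (\<lambda>a\<in>carrier P. \<lambda>n\<in>carrier (Ob N a). inv_into (carrier (Ob M a)) (f a) n)"
  have gf: "g a (f a m) = m" if "a \<in> carrier P" "m \<in> carrier (Ob M a)" for a m
    using that bij[OF that(1)] by (simp add: g_def rep_hom_closed[OF f] bij_betw_inv_into_left)
  have fg: "f a (g a n) = n" if "a \<in> carrier P" "n \<in> carrier (Ob N a)" for a n
    using that bij[OF that(1)] by (simp add: g_def bij_betw_inv_into_right)
  have ex: "\<exists>m\<in>carrier (Ob M a). n = f a m" if "a \<in> carrier P" "n \<in> carrier (Ob N a)" for a n
    using bij[OF that(1)] that(2) by (auto simp: bij_betw_def)
  have "g \<in> rep_hom k P N M"
  proof (rule rep_homI)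
    fix a assume a: "a \<in> carrier P"
    interpret Ma: module k "Ob M a" by (rule is_rep_module[OF M a])
    note lin = rep_hom_lin[OF f a]
    show "g a \<in> lin_maps k (Ob N a) (Ob M a)"
    proof (rule lin_mapsI)
      show "g a \<in> carrier (Ob N a) \<rightarrow>\<^sub>E carrier (Ob M a)"
      proof (rule PiE_I)
        show "g a n \<in> carrier (Ob M a)" if "n \<in> carrier (Ob N a)" for n
          using ex[OF a that] a by (auto simp: gf)
      qed (use a in \<open>simp add: g_def\<close>)
    next
      fix u v assume "u \<in> carrier (Ob N a)" "v \<in> carrier (Ob N a)"
      then obtain m n where "m \<in> carrier (Ob M a)" "u = f a m" "n \<in> carrier (Ob M a)" "v = f a n"
        using ex[OF a] by metis
      then show "g a (u \<oplus>\<^bsub>Ob N a\<^esub> v) = g a u \<oplus>\<^bsub>Ob M a\<^esub> g a v"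
        using a by (simp add: gf flip: lin_maps_add[OF lin])
    next
      fix c v assume "c \<in> carrier k" "v \<in> carrier (Ob N a)"
      then show "g a (c \<odot>\<^bsub>Ob N a\<^esub> v) = c \<odot>\<^bsub>Ob M a\<^esub> g a v"
        using a ex[OF a, of v] by (auto simp: gf simp flip: lin_maps_smult[OF lin])
    qed
  next
    fix a b n assume *: "a \<in> carrier P" "b \<in> carrier P" "a \<sqsubseteq>\<^bsub>P\<^esub> b" "n \<in> carrier (Ob N a)"
    then show "Mp M a b (g a n) = g b (Mp N a b n)"
      using ex[OF *(1,4)] by (auto simp: gf rep_hom_natural[OF f] is_rep_closed[OF M])
  qed (simp add: g_def)
  moreover have "rep_comp P M g f = rep_id P M" "rep_comp P N f g = rep_id P N"
    by (auto simp: rep_comp_def rep_id_def compose_def gf fg intro!: restrict_ext)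
  ultimately show ?thesis using f unfolding rep_iso_def by blast
qed

section \<open>Quotient representations and the homomorphism theorem\<close>

context
  fixes k :: "'k ring" and P :: "'p gorder" and S :: "('p, 'k, 'v) rep" and K :: "'p \<Rightarrow> 'v set"
  assumes S: "is_rep k P S" and K: "is_subrep k P K S"
begin

text \<open>Structure maps send K a into K b, so representatives that differ by K a have images that
  differ by K b, and the union in \<open>quot_rep\<close> collapses to one coset.\<close>

lemma Mp_quot_rep:
  assumes "a \<in> carrier P" "b \<in> carrier P" "a \<sqsubseteq>\<^bsub>P\<^esub> b" "m \<in> carrier (Ob S a)"
  shows "Mp (quot_rep S K) a b (K a +>\<^bsub>Ob S a\<^esub> m) = K b +>\<^bsub>Ob S b\<^esub> Mp S a b m"
proof -
  note a = is_rep_module[OF S assms(1)] is_subrepD(1)[OF K assms(1)]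
  note b = is_rep_module[OF S assms(2)] is_subrepD(1)[OF K assms(2)]
  note lin = is_rep_lin[OF S assms(1-3)]
  have "(\<Union>u\<in>K a +>\<^bsub>Ob S a\<^esub> m. K b +>\<^bsub>Ob S b\<^esub> Mp S a b u) = K b +>\<^bsub>Ob S b\<^esub> Mp S a b m"
  proof (rule coset_UN_eq[OF a assms(4)])
    fix u assume u: "u \<in> carrier (Ob S a)" "u \<ominus>\<^bsub>Ob S a\<^esub> m \<in> K a"
    have "Mp S a b u \<ominus>\<^bsub>Ob S b\<^esub> Mp S a b m \<in> K b"
      using is_subrepD(2)[OF K assms(1-3) u(2)] lin_maps_minus[OF a(1) b(1) lin u(1) assms(4)]
      by simp
    then show "K b +>\<^bsub>Ob S b\<^esub> Mp S a b u = K b +>\<^bsub>Ob S b\<^esub> Mp S a b m"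
      using u assms(4) by (subst coset_eq_iff[OF b]) (auto intro: lin_maps_closed[OF lin])
  qed
  moreover have "K a +>\<^bsub>Ob S a\<^esub> m \<in> a_rcosets\<^bsub>Ob S a\<^esub> K a"
    using coset_in_quot_mod[OF a assms(4)] by (simp add: quot_mod_def)
  ultimately show ?thesis by (simp add: quot_rep_def)
qed

text \<open>The first isomorphism theorem, with the isomorphism directed from N to the quotient, the
  form in which \<open>EN\<close> asks for it.\<close>

lemma rep_iso_quot_rep:
  assumes N: "is_rep k P N" and f: "f \<in> rep_hom k P S N"
    and surj: "\<And>a. a \<in> carrier P \<Longrightarrow> f a ` carrier (Ob S a) = carrier (Ob N a)"
    and ker: "\<And>a m. \<lbrakk>a \<in> carrier P; m \<in> carrier (Ob S a)\<rbrakk> \<Longrightarrow> f a m = \<zero>\<^bsub>Ob N a\<^esub> \<longleftrightarrow> m \<in> K a"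
  shows "rep_iso k P N (quot_rep S K)"
proof (rule rep_iso_bij[OF N])
  let ?q = "\<lambda>a m. K a +>\<^bsub>Ob S a\<^esub> m"
  \<comment> \<open>An element of N goes to the class of a chosen preimage. The equivalence
    \<open>eq\<close> below makes the choice immaterial and also gives injectivity.\<close>
  define g where "g = (\<lambda>a\<in>carrier P. \<lambda>n\<in>carrier (Ob N a).
    ?q a (inv_into (carrier (Ob S a)) (f a) n))"
  have eq: "?q a u = ?q a v \<longleftrightarrow> f a u = f a v"
    if "a \<in> carrier P" "u \<in> carrier (Ob S a)" "v \<in> carrier (Ob S a)" for a u v
  proof -
    interpret Sa: module k "Ob S a" by (rule is_rep_module[OF S that(1)])
    interpret Na: module k "Ob N a" by (rule is_rep_module[OF N that(1)])
    have "?q a u = ?q a v \<longleftrightarrow> f a (u \<ominus>\<^bsub>Ob S a\<^esub> v) = \<zero>\<^bsub>Ob N a\<^esub>"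
      using that by (simp add: coset_eq_iff[OF Sa.module_axioms is_subrepD(1)[OF K]] ker)
    also have "\<dots> \<longleftrightarrow> f a u = f a v"
      using that rep_hom_lin[OF f that(1)]
      by (simp add: lin_maps_minus[OF Sa.module_axioms Na.module_axioms] Na.minus_eq_zero_iff
          rep_hom_closed[OF f])
    finally show ?thesis .
  qed
  have g: "g a (f a m) = ?q a m" if "a \<in> carrier P" "m \<in> carrier (Ob S a)" for a m
  proof -
    have "inv_into (carrier (Ob S a)) (f a) (f a m) \<in> carrier (Ob S a)"
      "f a (inv_into (carrier (Ob S a)) (f a) (f a m)) = f a m"
      using that by (auto intro: inv_into_into f_inv_into_f)
    then show ?thesis
      using that by (simp add: g_def rep_hom_closed[OF f] eq)
  qed
  have ex: "\<exists>m\<in>carrier (Ob S a). n = f a m" if "a \<in> carrier P" "n \<in> carrier (Ob N a)" for a n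
    using surj[OF that(1)] that(2) by auto
  have Obq: "Ob (quot_rep S K) a = quot_mod (Ob S a) (K a)" for a
    by (simp add: quot_rep_def)
  show "g \<in> rep_hom k P N (quot_rep S K)"
  proof (rule rep_homI)
    fix a assume a: "a \<in> carrier P"
    note lin = rep_hom_lin[OF f a]
    note Sa = is_rep_module[OF S a] is_subrepD(1)[OF K a]
    interpret Sa: module k "Ob S a" by (rule Sa(1))
    show "g a \<in> lin_maps k (Ob N a) (Ob (quot_rep S K) a)"
      unfolding Obq
    proof (rule lin_mapsI)
      show "g a \<in> carrier (Ob N a) \<rightarrow>\<^sub>E carrier (quot_mod (Ob S a) (K a))"
      proof (rule PiE_I)
        show "g a n \<in> carrier (quot_mod (Ob S a) (K a))" if "n \<in> carrier (Ob N a)" for n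
          using ex[OF a that] a by (auto simp: g coset_in_quot_mod[OF Sa])
      qed (use a in \<open>simp add: g_def\<close>)
    next
      fix u v assume "u \<in> carrier (Ob N a)" "v \<in> carrier (Ob N a)"
      then obtain m n where "m \<in> carrier (Ob S a)" "u = f a m" "n \<in> carrier (Ob S a)" "v = f a n"
        using ex[OF a] by metis
      then show "g a (u \<oplus>\<^bsub>Ob N a\<^esub> v) = g a u \<oplus>\<^bsub>quot_mod (Ob S a) (K a)\<^esub> g a v"
        using a by (simp add: g coset_add[OF Sa] flip: lin_maps_add[OF lin])
    next
      fix c v assume "c \<in> carrier k" "v \<in> carrier (Ob N a)"
      then show "g a (c \<odot>\<^bsub>Ob N a\<^esub> v) = c \<odot>\<^bsub>quot_mod (Ob S a) (K a)\<^esub> g a v"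
        using a ex[OF a, of v] by (auto simp: g coset_smult[OF Sa] simp flip: lin_maps_smult[OF lin])
    qed
  next
    fix a b n assume *: "a \<in> carrier P" "b \<in> carrier P" "a \<sqsubseteq>\<^bsub>P\<^esub> b" "n \<in> carrier (Ob N a)"
    then show "Mp (quot_rep S K) a b (g a n) = g b (Mp N a b n)"
      using ex[OF *(1,4)] by (auto simp: g Mp_quot_rep rep_hom_natural[OF f] is_rep_closed[OF S])
  qed (simp add: g_def)
  fix a assume a: "a \<in> carrier P"
  note Sa = is_rep_module[OF S a] is_subrepD(1)[OF K a]
  show "module k (Ob (quot_rep S K) a)"
    unfolding Obq by (rule module_quot_mod[OF Sa])
  show "bij_betw (g a) (carrier (Ob N a)) (carrier (Ob (quot_rep S K) a))"
    using a surj[OF a, symmetric] unfolding bij_betw_def Obq carrier_quot_mod[OF Sa]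
    by (auto simp: g eq image_image intro!: inj_onI)
qed

text \<open>Conversely, the canonical projection followed by the inverse isomorphism h presents N by
  a surjection f from S. It lets later arguments work with elements of S and N alone.\<close>

lemma quot_rep_proj:
  assumes N: "is_rep k P N" and iso: "rep_iso k P N (quot_rep S K)"
  obtains f where "f \<in> rep_hom k P S N"
    and "\<And>a. a \<in> carrier P \<Longrightarrow> f a ` carrier (Ob S a) = carrier (Ob N a)"
    and "\<And>a m. \<lbrakk>a \<in> carrier P; m \<in> carrier (Ob S a); f a m = \<zero>\<^bsub>Ob N a\<^esub>\<rbrakk> \<Longrightarrow> m \<in> K a"
proof -
  let ?Q = "quot_rep S K"
  obtain g h where g: "g \<in> rep_hom k P N ?Q" and h: "h \<in> rep_hom k P ?Q N"
    and hg: "rep_comp P N h g = rep_id P N" and gh: "rep_comp P ?Q g h = rep_id P ?Q"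
    using iso unfolding rep_iso_def by blast
  have Obq: "Ob ?Q a = quot_mod (Ob S a) (K a)" for a
    by (simp add: quot_rep_def)
  have hg': "h a (g a n) = n" if "a \<in> carrier P" "n \<in> carrier (Ob N a)" for a n
    using fun_cong[OF fun_cong[OF hg], of a n] that by (simp add: rep_comp_def rep_id_def compose_def)
  have gh': "g a (h a n) = n" if "a \<in> carrier P" "n \<in> carrier (Ob ?Q a)" for a n
    using fun_cong[OF fun_cong[OF gh], of a n] that by (simp add: rep_comp_def rep_id_def compose_def)
  define f where "f = (\<lambda>a\<in>carrier P. compose (carrier (Ob S a)) (h a)
    (\<lambda>m\<in>carrier (Ob S a). K a +>\<^bsub>Ob S a\<^esub> m))"
  have f: "f a m = h a (K a +>\<^bsub>Ob S a\<^esub> m)" if "a \<in> carrier P" "m \<in> carrier (Ob S a)" for a m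
    using that by (simp add: f_def compose_def)
  have coset: "K a +>\<^bsub>Ob S a\<^esub> m \<in> carrier (Ob ?Q a)"
    if "a \<in> carrier P" "m \<in> carrier (Ob S a)" for a m
    unfolding Obq using that
    by (simp add: coset_in_quot_mod[OF is_rep_module[OF S] is_subrepD(1)[OF K]])
  show thesis
  proof (rule that)
    show "f \<in> rep_hom k P S N"
    proof (rule rep_homI)
      fix a assume a: "a \<in> carrier P"
      note Sa = is_rep_module[OF S a] is_subrepD(1)[OF K a]
      show "f a \<in> lin_maps k (Ob S a) (Ob N a)"
        using a lin_maps_compose[OF rep_hom_lin[OF h a, unfolded Obq] quot_mod_proj[OF Sa] Sa(1)]
        by (simp add: f_def)
    next
      fix a b m assume "a \<in> carrier P" "b \<in> carrier P" "a \<sqsubseteq>\<^bsub>P\<^esub> b" "m \<in> carrier (Ob S a)"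
      then show "Mp N a b (f a m) = f b (Mp S a b m)"
        by (simp add: f coset rep_hom_natural[OF h] Mp_quot_rep is_rep_closed[OF S])
    qed (simp add: f_def)
  next
    fix a assume a: "a \<in> carrier P"
    note Sa = is_rep_module[OF S a] is_subrepD(1)[OF K a]
    have "\<exists>m\<in>carrier (Ob S a). n = f a m" if n: "n \<in> carrier (Ob N a)" for n
    proof -
      have "g a n \<in> carrier (Ob ?Q a)" by (rule rep_hom_closed[OF g a n])
      then obtain m where m: "m \<in> carrier (Ob S a)" "g a n = K a +>\<^bsub>Ob S a\<^esub> m"
        unfolding Obq carrier_quot_mod[OF Sa] by blast
      then have "n = f a m" using hg'[OF a n] a by (simp add: f)
      with m(1) show ?thesis by blast
    qed
    with a show "f a ` carrier (Ob S a) = carrier (Ob N a)"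
      by (auto simp: f coset intro!: rep_hom_closed[OF h])
  next
    fix a m assume a: "a \<in> carrier P" and m: "m \<in> carrier (Ob S a)" and 0: "f a m = \<zero>\<^bsub>Ob N a\<^esub>"
    note Sa = is_rep_module[OF S a] is_subrepD(1)[OF K a]
    interpret Sa: module k "Ob S a" by (rule Sa(1))
    \<comment> \<open>A zero of f is compared with the class of zero; \<open>gh'\<close> makes h
      injective, so the two classes agree.\<close>
    have "h a (K a +>\<^bsub>Ob S a\<^esub> m) = h a (K a +>\<^bsub>Ob S a\<^esub> \<zero>\<^bsub>Ob S a\<^esub>)"
      using a m 0 lin_maps_zero[OF module_quot_mod[OF Sa] is_rep_module[OF N a]
          rep_hom_lin[OF h a, unfolded Obq]]
      by (simp add: f zero_quot_mod[OF Sa])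
    then have "K a +>\<^bsub>Ob S a\<^esub> m = K a +>\<^bsub>Ob S a\<^esub> \<zero>\<^bsub>Ob S a\<^esub>"
      using a m gh' coset by (metis Sa.M.zero_closed)
    moreover have "\<ominus>\<^bsub>Ob S a\<^esub> \<zero>\<^bsub>Ob S a\<^esub> = \<zero>\<^bsub>Ob S a\<^esub>"
      by (rule Sa.M.minus_equality) simp_all
    ultimately show "m \<in> K a"
      using m by (simp add: coset_eq_iff[OF Sa] Sa.M.minus_eq)
  qed
qed

end


section \<open>The functors L and R\<close>

locale height_setting = height_difference P rho
  for P :: "'p gorder" (structure) and rho :: "'p \<Rightarrow> 'p \<Rightarrow> ennreal" +
  fixes k :: "'k ring" and r :: real
  assumes k: "cring k"
begin

abbreviation "D \<equiv> down P rho r"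
abbreviation "U \<equiv> up P rho r"
abbreviation "L M \<equiv> L_rep k P rho r M"
abbreviation "R M \<equiv> R_rep P rho r M"
abbreviation "\<alpha> M \<equiv> alpha k P rho r M"
abbreviation "\<eta>L M \<equiv> eta_L k P rho r M"
abbreviation "\<eta>R M \<equiv> eta_R P rho r M"

section \<open>The index sets D and U\<close>

lemma down_subset: "D a \<subseteq> carrier P"
  by (auto simp: down_def)

lemma up_subset: "U a \<subseteq> carrier P"
  by (auto simp: up_def)

lemma downD: "x \<in> D a \<Longrightarrow> x \<in> carrier P" "x \<in> D a \<Longrightarrow> x \<sqsubseteq> a"
  by (auto simp: down_def)

lemma upD: "y \<in> U a \<Longrightarrow> y \<in> carrier P" "y \<in> U a \<Longrightarrow> a \<sqsubseteq> y"
  by (auto simp: up_def)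

text \<open>Both sides say that x \<le> a and rho(x, a) \<ge> r. This symmetry underlies the
  adjunction between L and R.\<close>

lemma down_iff_up: "\<lbrakk>a \<in> carrier P; x \<in> carrier P\<rbrakk> \<Longrightarrow> x \<in> D a \<longleftrightarrow> a \<in> U x"
  by (auto simp: up_def down_def)

text \<open>Superadditivity and nonnegativity of rho give rho(x, a) \<le> rho(x, a) + rho(a, b)
  \<le> rho(x, b).\<close>

lemma down_mono:
  assumes "a \<in> carrier P" "b \<in> carrier P" "a \<sqsubseteq> b"
  shows "D a \<subseteq> D b"
proof
  fix x assume x: "x \<in> D a"
  then have "rho x a \<le> rho x b"
    using rho_superadditive[of x a b] assms by (auto simp: down_def intro: order_trans[rotated])
  with x assms show "x \<in> D b" by (auto simp: down_def intro: le_trans order_trans)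
qed

lemma up_antimono:
  assumes "a \<in> carrier P" "b \<in> carrier P" "a \<sqsubseteq> b"
  shows "U b \<subseteq> U a"
proof
  fix y assume y: "y \<in> U b"
  then have "rho b y \<le> rho a y"
    using rho_superadditive[of a b y] assms by (auto simp: up_def intro: order_trans[rotated])
  with y assms show "y \<in> U a" by (auto simp: up_def intro: le_trans order_trans)
qed

lemma Ob_L: "Ob (L M) a = colim k P (D a) M"
  by (simp add: L_rep_def)

lemma Ob_R: "Ob (R M) a = limit P (U a) M"
  by (simp add: R_rep_def)

context
  fixes M :: "('p, 'k, 'v) rep"
  assumes M: "is_rep k P M"
begin

section \<open>The functor L\<close>

lemma alpha_lin: "x \<in> D a \<Longrightarrow> \<alpha> M a x \<in> lin_maps k (Ob M x) (Ob (L M) a)"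
  unfolding alpha_def Ob_L by (rule colim_in_lin[OF k M down_subset])

lemma alpha_natural:
  "\<lbrakk>x \<in> D a; y \<in> D a; x \<sqsubseteq> y; m \<in> carrier (Ob M x)\<rbrakk> \<Longrightarrow> \<alpha> M a y (Mp M x y m) = \<alpha> M a x m"
  unfolding alpha_def by (rule colim_in_natural[OF k M down_subset])

lemma alpha_closed: "\<lbrakk>x \<in> D a; m \<in> carrier (Ob M x)\<rbrakk> \<Longrightarrow> \<alpha> M a x m \<in> carrier (Ob (L M) a)"
  using lin_maps_closed[OF alpha_lin] .

lemma module_L: "module k (Ob (L M) a)"
  unfolding Ob_L by (rule module_colim[OF k M down_subset])

lemma L_ext:
  assumes "g \<in> lin_maps k (Ob (L M) a) W" "h \<in> lin_maps k (Ob (L M) a) W" "module k W"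
    and "\<And>x m. \<lbrakk>x \<in> D a; m \<in> carrier (Ob M x)\<rbrakk> \<Longrightarrow> g (\<alpha> M a x m) = h (\<alpha> M a x m)"
  shows "g = h"
  using assms unfolding alpha_def Ob_L by (intro colim_ext[OF k M down_subset])

lemma
  assumes "a \<in> carrier P" "b \<in> carrier P" "a \<sqsubseteq> b"
  shows L_Mp_lin: "Mp (L M) a b \<in> lin_maps k (Ob (L M) a) (Ob (L M) b)"
    and L_Mp_alpha: "\<lbrakk>x \<in> D a; m \<in> carrier (Ob M x)\<rbrakk> \<Longrightarrow> Mp (L M) a b (\<alpha> M a x m) = \<alpha> M b x m"
proof -
  note sub = down_mono[OF assms]
  have Mp: "Mp (L M) a b = colim_desc k P (D a) M (Ob (L M) b) (\<alpha> M b)"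
    by (simp add: L_rep_def)
  show "Mp (L M) a b \<in> lin_maps k (Ob (L M) a) (Ob (L M) b)"
    unfolding Mp Ob_L[of _ a]
    by (rule colim_desc_lin[OF k M down_subset module_L alpha_lin])
      (use sub in \<open>auto simp: subset_eq alpha_natural\<close>)
  show "Mp (L M) a b (\<alpha> M a x m) = \<alpha> M b x m" if "x \<in> D a" "m \<in> carrier (Ob M x)"
    unfolding Mp alpha_def[of _ _ _ _ _ a]
    by (rule colim_desc_in[OF k M down_subset module_L alpha_lin])
      (use sub that in \<open>auto simp: subset_eq alpha_natural\<close>)
qed

text \<open>Both functor laws equate linear maps out of a colimit, so \<open>L_ext\<close> reduces
  them to the generators, where a structure map of L only changes the base point of
  \<alpha>.\<close>

lemma is_rep_L: "is_rep k P (L M)"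
  unfolding is_rep_def
proof (intro conjI ballI impI)
  fix a assume a: "a \<in> carrier P"
  show "module k (Ob (L M) a)" by (rule module_L)
  interpret La: module k "Ob (L M) a" by (rule module_L)
  show "Mp (L M) a a = (\<lambda>m\<in>carrier (Ob (L M) a). m)"
  proof (rule L_ext[where a = a])
    show "(\<lambda>m\<in>carrier (Ob (L M) a). m) \<in> lin_maps k (Ob (L M) a) (Ob (L M) a)"
      by (rule lin_mapsI) auto
  qed (use a in \<open>auto simp: L_Mp_lin L_Mp_alpha alpha_closed module_L\<close>)
  fix b assume b: "b \<in> carrier P"
  show "a \<sqsubseteq> b \<Longrightarrow> Mp (L M) a b \<in> lin_maps k (Ob (L M) a) (Ob (L M) b)"
    by (rule L_Mp_lin[OF a b])
  fix c assume c: "c \<in> carrier P" and le: "a \<sqsubseteq> b" "b \<sqsubseteq> c"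
  have ac: "a \<sqsubseteq> c" using le a b c le_trans by blast
  show "Mp (L M) a c = compose (carrier (Ob (L M) a)) (Mp (L M) b c) (Mp (L M) a b)"
  proof (rule L_ext[OF L_Mp_lin[OF a c ac] lin_maps_compose[where V = "Ob (L M) b"] module_L])
    show "Mp (L M) a c (\<alpha> M a x m)
      = compose (carrier (Ob (L M) a)) (Mp (L M) b c) (Mp (L M) a b) (\<alpha> M a x m)"
      if x: "x \<in> D a" and m: "m \<in> carrier (Ob M x)" for x m
    proof -
      have "x \<in> D b" using down_mono[OF a b le(1)] x by blast
      then show ?thesis
        using x m by (simp add: compose_eq alpha_closed L_Mp_alpha a b c le ac)
    qed
  qed (use a b c le in \<open>auto simp: L_Mp_lin module_L\<close>)
qed

lemma eta_L_lin: "a \<in> carrier P \<Longrightarrow> \<eta>L M a \<in> lin_maps k (Ob (L M) a) (Ob M a)"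
  and eta_L_alpha: "\<lbrakk>a \<in> carrier P; x \<in> D a; m \<in> carrier (Ob M x)\<rbrakk> \<Longrightarrow> \<eta>L M a (\<alpha> M a x m) = Mp M x a m"
proof -
  assume a: "a \<in> carrier P"
  then have eta: "\<eta>L M a = colim_desc k P (D a) M (Ob M a) (\<lambda>x. Mp M x a)"
    by (simp add: eta_L_def)
  show "\<eta>L M a \<in> lin_maps k (Ob (L M) a) (Ob M a)"
    unfolding eta Ob_L
    by (rule colim_desc_lin[OF k M down_subset is_rep_module[OF M a]])
      (use a in \<open>auto simp: downD is_rep_lin[OF M] is_rep_comp[OF M]\<close>)
  show "\<eta>L M a (\<alpha> M a x m) = Mp M x a m" if "x \<in> D a" "m \<in> carrier (Ob M x)"
    unfolding eta alpha_def
    by (rule colim_desc_in[OF k M down_subset is_rep_module[OF M a]])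
      (use a that in \<open>auto simp: downD is_rep_lin[OF M] is_rep_comp[OF M]\<close>)
qed

text \<open>By joint surjectivity naturality has to be tested on generators only; there the
  structure map of L has been evaluated already.\<close>

lemma rep_hom_L_I:
  assumes N: "is_rep k P N" and ext: "f \<in> extensional (carrier P)"
    and lin: "\<And>a. a \<in> carrier P \<Longrightarrow> f a \<in> lin_maps k (Ob (L M) a) (Ob N a)"
    and nat: "\<And>a b x m. \<lbrakk>a \<in> carrier P; b \<in> carrier P; a \<sqsubseteq> b; x \<in> D a; m \<in> carrier (Ob M x)\<rbrakk>
      \<Longrightarrow> Mp N a b (f a (\<alpha> M a x m)) = f b (\<alpha> M b x m)"
  shows "f \<in> rep_hom k P (L M) N"
proof (rule rep_homI[OF ext lin])
  fix a b l assume a: "a \<in> carrier P" and b: "b \<in> carrier P" and ab: "a \<sqsubseteq> b"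
    and l: "l \<in> carrier (Ob (L M) a)"
  let ?c = "compose (carrier (Ob (L M) a))"
  have "?c (Mp N a b) (f a) = ?c (f b) (Mp (L M) a b)"
  proof (rule L_ext[OF lin_maps_compose[where V = "Ob N a"]
        lin_maps_compose[where V = "Ob (L M) b"] is_rep_module[OF N b]])
    show "?c (Mp N a b) (f a) (\<alpha> M a x m) = ?c (f b) (Mp (L M) a b) (\<alpha> M a x m)"
      if "x \<in> D a" "m \<in> carrier (Ob M x)" for x m
      using that a b ab by (simp add: compose_eq alpha_closed L_Mp_alpha nat)
  qed (use a b ab in \<open>auto simp: L_Mp_lin module_L is_rep_lin[OF N] lin\<close>)
  from fun_cong[OF this, of l] l show "Mp N a b (f a l) = f b (Mp (L M) a b l)"
    by (simp add: compose_eq)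
qed

lemma eta_L_hom: "\<eta>L M \<in> rep_hom k P (L M) M"
proof (rule rep_hom_L_I[OF M])
  fix a b x m assume *: "a \<in> carrier P" "b \<in> carrier P" "a \<sqsubseteq> b" "x \<in> D a" "m \<in> carrier (Ob M x)"
  moreover have "x \<in> D b" using down_mono * by blast
  ultimately show "Mp M a b (\<eta>L M a (\<alpha> M a x m)) = \<eta>L M b (\<alpha> M b x m)"
    by (simp add: eta_L_alpha is_rep_comp[OF M] downD)
qed (auto simp: eta_L_lin, simp add: eta_L_def)

section \<open>The functor R\<close>

lemma module_R: "module k (Ob (R M) a)"
  unfolding Ob_R by (rule module_limit[OF k M up_subset])

lemma R_memI:
  assumes "\<And>y. y \<in> U a \<Longrightarrow> f y \<in> carrier (Ob M y)"
    and "\<And>y z. \<lbrakk>y \<in> U a; z \<in> U a; y \<sqsubseteq> z\<rbrakk> \<Longrightarrow> Mp M y z (f y) = f z"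
  shows "(\<lambda>y\<in>U a. f y) \<in> carrier (Ob (R M) a)"
  unfolding Ob_R using assms by (rule limit_memI[OF k M up_subset])

lemma R_memD:
  assumes "s \<in> carrier (Ob (R M) a)"
  shows "y \<in> U a \<Longrightarrow> s y \<in> carrier (Ob M y)"
    and "\<lbrakk>y \<in> U a; z \<in> U a; y \<sqsubseteq> z\<rbrakk> \<Longrightarrow> Mp M y z (s y) = s z"
    and "restrict s (U a) = s"
proof -
  have s: "s \<in> carrier (limit P (U a) M)" using assms by (simp add: Ob_R)
  show "y \<in> U a \<Longrightarrow> s y \<in> carrier (Ob M y)"
    and "\<lbrakk>y \<in> U a; z \<in> U a; y \<sqsubseteq> z\<rbrakk> \<Longrightarrow> Mp M y z (s y) = s z"
    using limit_memD[OF k M up_subset s] by auto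
  show "restrict s (U a) = s"
    using s by (simp add: limit_def PiE_def extensional_restrict)
qed

lemma R_ext:
  assumes "s \<in> carrier (Ob (R M) a)" "t \<in> carrier (Ob (R M) a)" "\<And>y. y \<in> U a \<Longrightarrow> s y = t y"
  shows "s = t"
  using assms unfolding Ob_R by (rule limit_ext[OF k M up_subset])

lemma R_ops:
  "\<zero>\<^bsub>Ob (R M) a\<^esub> = (\<lambda>y\<in>U a. \<zero>\<^bsub>Ob M y\<^esub>)"
  "s \<oplus>\<^bsub>Ob (R M) a\<^esub> t = (\<lambda>y\<in>U a. s y \<oplus>\<^bsub>Ob M y\<^esub> t y)"
  "c \<odot>\<^bsub>Ob (R M) a\<^esub> s = (\<lambda>y\<in>U a. c \<odot>\<^bsub>Ob M y\<^esub> s y)"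
  by (simp_all add: R_rep_def limit_def)

text \<open>The operations of the limit are pointwise, so linearity is inherited from the components
  of the cone.\<close>

lemma lin_maps_R_I:
  assumes V: "module k V" and f: "\<And>y. y \<in> U a \<Longrightarrow> f y \<in> lin_maps k V (Ob M y)"
    and cone: "\<And>y z v. \<lbrakk>y \<in> U a; z \<in> U a; y \<sqsubseteq> z; v \<in> carrier V\<rbrakk> \<Longrightarrow> Mp M y z (f y v) = f z v"
  shows "(\<lambda>v\<in>carrier V. \<lambda>y\<in>U a. f y v) \<in> lin_maps k V (Ob (R M) a)"
proof -
  interpret V: module k V by fact
  show ?thesis
  proof (rule lin_mapsI)
    show "(\<lambda>v\<in>carrier V. \<lambda>y\<in>U a. f y v) \<in> carrier V \<rightarrow>\<^sub>E carrier (Ob (R M) a)"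
      by (auto intro!: R_memI lin_maps_closed[OF f] cone)
  qed (auto simp: R_ops lin_maps_add[OF f] lin_maps_smult[OF f] intro!: restrict_ext)
qed

lemma R_eval_lin: "y \<in> U a \<Longrightarrow> (\<lambda>s\<in>carrier (Ob (R M) a). s y) \<in> lin_maps k (Ob (R M) a) (Ob M y)"
proof -
  assume y: "y \<in> U a"
  interpret R: module k "Ob (R M) a" by (rule module_R)
  show ?thesis
    by (rule lin_mapsI) (use R.M.a_closed R.smult_closed in \<open>auto simp: R_memD y R_ops\<close>)
qed

text \<open>The lift of the projections \<open>beta\<close> at a to the smaller index set U b is
  restriction of families.\<close>

lemma Mp_R:
  assumes "a \<in> carrier P" "b \<in> carrier P" "a \<sqsubseteq> b"
  shows "Mp (R M) a b = (\<lambda>s\<in>carrier (Ob (R M) a). \<lambda>y\<in>U b. s y)"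
  using up_antimono[OF assms]
  by (auto simp: R_rep_def limit_lift_def beta_def limit_out_def intro!: restrict_ext)

lemma R_Mp_apply:
  "\<lbrakk>a \<in> carrier P; b \<in> carrier P; a \<sqsubseteq> b; s \<in> carrier (Ob (R M) a); y \<in> U b\<rbrakk> \<Longrightarrow> Mp (R M) a b s y = s y"
  by (simp add: Mp_R)

lemma is_rep_R: "is_rep k P (R M)"
  unfolding is_rep_def
proof (intro conjI ballI impI)
  fix a assume a: "a \<in> carrier P"
  show "module k (Ob (R M) a)" by (rule module_R)
  show "Mp (R M) a a = (\<lambda>m\<in>carrier (Ob (R M) a). m)"
    using a by (auto simp: Mp_R R_memD intro!: restrict_ext)
  fix b assume b: "b \<in> carrier P"
  show lin: "Mp (R M) a b \<in> lin_maps k (Ob (R M) a) (Ob (R M) b)" if ab: "a \<sqsubseteq> b"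
  proof -
    \<comment> \<open>The inner restriction makes each evaluation extensional, as membership in
      \<open>lin_maps\<close> demands; the following step removes it.\<close>
    have "(\<lambda>s\<in>carrier (Ob (R M) a). \<lambda>y\<in>U b. (\<lambda>s\<in>carrier (Ob (R M) a). s y) s)
        \<in> lin_maps k (Ob (R M) a) (Ob (R M) b)"
      using up_antimono[OF a b ab]
      by (intro lin_maps_R_I[OF module_R] R_eval_lin) (auto simp: subset_eq R_memD)
    also have "(\<lambda>s\<in>carrier (Ob (R M) a). \<lambda>y\<in>U b. (\<lambda>s\<in>carrier (Ob (R M) a). s y) s) = Mp (R M) a b"
      using a b ab by (auto simp: Mp_R intro!: restrict_ext)
    finally show ?thesis .
  qed
  fix c assume c: "c \<in> carrier P" and le: "a \<sqsubseteq> b" "b \<sqsubseteq> c"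
  have ac: "a \<sqsubseteq> c" using le a b c le_trans by blast
  show "Mp (R M) a c = compose (carrier (Ob (R M) a)) (Mp (R M) b c) (Mp (R M) a b)"
    using a b c le ac up_antimono[OF b c le(2)] lin_maps_closed[OF lin[OF le(1)]]
    by (auto simp: Mp_R compose_def Int_absorb1 intro!: restrict_ext)
qed

lemma eta_R_apply:
  "\<lbrakk>a \<in> carrier P; m \<in> carrier (Ob M a)\<rbrakk> \<Longrightarrow> \<eta>R M a m = (\<lambda>y\<in>U a. Mp M a y m)"
  by (simp add: eta_R_def limit_lift_def)

text \<open>Structure maps of R restrict families, so naturality can be tested entry by entry on the
  smaller index set U b.\<close>

lemma rep_hom_R_I:
  assumes N: "is_rep k P N" and ext: "f \<in> extensional (carrier P)"
    and lin: "\<And>a. a \<in> carrier P \<Longrightarrow> f a \<in> lin_maps k (Ob N a) (Ob (R M) a)"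
    and nat: "\<And>a b y n. \<lbrakk>a \<in> carrier P; b \<in> carrier P; a \<sqsubseteq> b; y \<in> U b; n \<in> carrier (Ob N a)\<rbrakk>
      \<Longrightarrow> f a n y = f b (Mp N a b n) y"
  shows "f \<in> rep_hom k P N (R M)"
proof (rule rep_homI[OF ext lin])
  fix a b n assume *: "a \<in> carrier P" "b \<in> carrier P" "a \<sqsubseteq> b" "n \<in> carrier (Ob N a)"
  show "Mp (R M) a b (f a n) = f b (Mp N a b n)"
  proof (rule R_ext)
    show "Mp (R M) a b (f a n) \<in> carrier (Ob (R M) b)"
      using * by (intro is_rep_closed[OF is_rep_R] lin_maps_closed[OF lin])
    show "f b (Mp N a b n) \<in> carrier (Ob (R M) b)"
      using * by (intro lin_maps_closed[OF lin] is_rep_closed[OF N])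
    show "Mp (R M) a b (f a n) y = f b (Mp N a b n) y" if "y \<in> U b" for y
      using * that nat by (simp add: R_Mp_apply lin_maps_closed[OF lin])
  qed
qed

lemma eta_R_hom: "\<eta>R M \<in> rep_hom k P M (R M)"
proof (rule rep_hom_R_I[OF M])
  fix a assume a: "a \<in> carrier P"
  have "(\<lambda>m\<in>carrier (Ob M a). \<lambda>y\<in>U a. Mp M a y m) \<in> lin_maps k (Ob M a) (Ob (R M) a)"
    using a by (intro lin_maps_R_I is_rep_module[OF M] is_rep_lin[OF M])
      (auto simp: upD is_rep_comp[OF M])
  with a show "\<eta>R M a \<in> lin_maps k (Ob M a) (Ob (R M) a)"
    by (simp add: eta_R_def limit_lift_def)
next
  fix a b y n assume *: "a \<in> carrier P" "b \<in> carrier P" "a \<sqsubseteq> b" "y \<in> U b" "n \<in> carrier (Ob M a)"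
  moreover have "y \<in> U a" using up_antimono * by blast
  ultimately show "\<eta>R M a n y = \<eta>R M b (Mp M a b n) y"
    by (simp add: eta_R_apply is_rep_closed[OF M] is_rep_comp[OF M] upD)
qed (simp add: eta_R_def)

end

text \<open>For fixed a the maps sending m to \<open>p x m a\<close>, with x in D a, form a cocone
  on N a: the entry at a exists because a lies in U x. The induced maps form the unique morphism
  that \<open>sharp\<close> describes.\<close>

lemma
  fixes M :: "('p, 'k, 'v) rep" and N :: "('p, 'k, 'w) rep"
  assumes M: "is_rep k P M" and N: "is_rep k P N" and p: "p \<in> rep_hom k P M (R N)"
  shows sharp_hom: "sharp k P rho r M N p \<in> rep_hom k P (L M) N"
    and sharp_alpha: "\<lbrakk>a \<in> carrier P; x \<in> D a; m \<in> carrier (Ob M x)\<rbrakk>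
      \<Longrightarrow> sharp k P rho r M N p a (\<alpha> M a x m) = p x m a"
proof -
  have Ux: "a \<in> U x" if "a \<in> carrier P" "x \<in> D a" for a x
    using that down_iff_up downD by blast
  have pmem: "p x m \<in> carrier (Ob (R N) x)" if "x \<in> carrier P" "m \<in> carrier (Ob M x)" for x m
    by (rule rep_hom_closed[OF p that])
  define f where "f a x = (\<lambda>m\<in>carrier (Ob M x). p x m a)" for a x
  have f_lin: "f a x \<in> lin_maps k (Ob M x) (Ob N a)" if "a \<in> carrier P" "x \<in> D a" for a x
  proof -
    have "compose (carrier (Ob M x)) (\<lambda>s\<in>carrier (Ob (R N) x). s a) (p x) \<in> lin_maps k (Ob M x) (Ob N a)"
      using that downD Ux
      by (intro lin_maps_compose[OF R_eval_lin[OF N] rep_hom_lin[OF p]] is_rep_module[OF M]) auto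
    also have "compose (carrier (Ob M x)) (\<lambda>s\<in>carrier (Ob (R N) x). s a) (p x) = f a x"
      using that by (auto simp: f_def compose_def pmem downD intro!: restrict_ext)
    finally show ?thesis .
  qed
  \<comment> \<open>The cocone condition is naturality of p: passing from x to y restricts the
    family \<open>p x m\<close>, and its entry at a is kept.\<close>
  have f_nat: "f a y (Mp M x y m) = f a x m"
    if a: "a \<in> carrier P" and x: "x \<in> D a" and y: "y \<in> D a" and xy: "x \<sqsubseteq> y"
      and m: "m \<in> carrier (Ob M x)" for a x y m
  proof -
    note xP = downD(1)[OF x] and yP = downD(1)[OF y]
    have "p y (Mp M x y m) = Mp (R N) x y (p x m)"
      using rep_hom_natural[OF p xP yP xy m] by simp
    then show ?thesis
      using R_Mp_apply[OF N xP yP xy pmem[OF xP m] Ux[OF a y]] m is_rep_closed[OF M xP yP xy m]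
      by (simp add: f_def)
  qed
  define q where "q = (\<lambda>a\<in>carrier P. colim_desc k P (D a) M (Ob N a) (f a))"
  have q_lin: "q a \<in> lin_maps k (Ob (L M) a) (Ob N a)" if "a \<in> carrier P" for a
    using that colim_desc_lin[OF k M down_subset is_rep_module[OF N], of a a "f a"]
    by (simp add: q_def Ob_L f_lin f_nat)
  have q_alpha: "q a (\<alpha> M a x m) = p x m a"
    if "a \<in> carrier P" "x \<in> D a" "m \<in> carrier (Ob M x)" for a x m
    using that colim_desc_in[OF k M down_subset is_rep_module[OF N], of a a "f a" x m]
    by (simp add: q_def alpha_def f_lin f_nat) (simp add: f_def)
  have q_ext: "q \<in> extensional (carrier P)"
    by (simp add: q_def)
  have q_hom: "q \<in> rep_hom k P (L M) N"
  proof (rule rep_hom_L_I[OF M N q_ext q_lin])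
    fix a b x m assume *: "a \<in> carrier P" "b \<in> carrier P" "a \<sqsubseteq> b" "x \<in> D a" "m \<in> carrier (Ob M x)"
    moreover have "x \<in> D b" using down_mono * by blast
    \<comment> \<open>On generators, naturality of q is the compatibility of the single family
      \<open>p x m\<close> along a \<le> b, both in U x.\<close>
    ultimately show "Mp N a b (q a (\<alpha> M a x m)) = q b (\<alpha> M b x m)"
      by (simp add: q_alpha R_memD[OF N pmem] Ux downD)
  qed
  have beta: "compose (carrier (Ob M x)) (beta P rho r N x a) (p x) = f a x"
    if "a \<in> carrier P" "x \<in> D a" for a x
    using that pmem[unfolded Ob_R] by (auto simp: compose_def beta_def limit_out_def f_def downD
        intro!: restrict_ext)
  have "sharp k P rho r M N p = q"
    unfolding sharp_def
  proof (rule the_equality)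
    show "q \<in> rep_hom k P (L M) N \<and> (\<forall>a\<in>carrier P. \<forall>x\<in>D a.
        compose (carrier (Ob M x)) (q a) (\<alpha> M a x) = compose (carrier (Ob M x)) (beta P rho r N x a) (p x))"
      using q_hom by (auto simp: beta) (auto simp: compose_def f_def q_alpha intro!: restrict_ext)
  next
    fix h assume h: "h \<in> rep_hom k P (L M) N \<and> (\<forall>a\<in>carrier P. \<forall>x\<in>D a.
        compose (carrier (Ob M x)) (h a) (\<alpha> M a x) = compose (carrier (Ob M x)) (beta P rho r N x a) (p x))"
    have "h a (\<alpha> M a x m) = p x m a"
      if "a \<in> carrier P" "x \<in> D a" "m \<in> carrier (Ob M x)" for a x m
    proof -
      have "compose (carrier (Ob M x)) (h a) (\<alpha> M a x) = f a x"
        using h that beta by simp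
      from fun_cong[OF this, of m] that show ?thesis by (simp add: compose_eq f_def)
    qed
    \<comment> \<open>Two candidates agree on generators, hence at each a; extensionality in a then
      identifies them as functions.\<close>
    then have "h a = q a" if "a \<in> carrier P" for a
      using that h rep_hom_lin[of h] q_lin is_rep_module[OF N] q_alpha
      by (intro L_ext[OF M, where a = a and W = "Ob N a"]) auto
    then show "h = q"
      using h rep_hom_extensional[of h] rep_hom_extensional[OF q_hom]
      by (intro extensionalityI[where A = "carrier P"]) auto
  qed
  then show "sharp k P rho r M N p \<in> rep_hom k P (L M) N"
    and "\<lbrakk>a \<in> carrier P; x \<in> D a; m \<in> carrier (Ob M x)\<rbrakk>
      \<Longrightarrow> sharp k P rho r M N p a (\<alpha> M a x m) = p x m a"
    using q_hom q_alpha by auto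
qed

end


section \<open>Erosion neighborhoods and interleavings\<close>

context height_setting
begin

lemma e_map_apply:
  assumes "a \<in> carrier P"
  shows "e_map k P rho r M a = compose (carrier (Ob (L M) a)) (\<eta>R M a) (\<eta>L M a)"
  using assms by (simp add: e_map_def rep_comp_def)

lemma e_map_alpha:
  assumes "is_rep k P M" "a \<in> carrier P" "x \<in> D a" "m \<in> carrier (Ob M x)"
  shows "e_map k P rho r M a (\<alpha> M a x m) = \<eta>R M a (Mp M x a m)"
  using assms by (simp add: e_map_apply compose_eq alpha_closed eta_L_alpha)

lemma e_map_lin:
  assumes M: "is_rep k P M" and a: "a \<in> carrier P"
  shows "e_map k P rho r M a \<in> lin_maps k (Ob (L M) a) (Ob (R M) a)"
  unfolding e_map_apply[OF a]
  by (rule lin_maps_compose[OF rep_hom_lin[OF eta_R_hom[OF M] a] eta_L_lin[OF M a] module_L[OF M]])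

text \<open>This makes the image of \<open>e_map\<close> a subrepresentation of R M, hence
  \<open>erosion\<close> a representation.\<close>

lemma e_map_hom:
  assumes M: "is_rep k P M"
  shows "e_map k P rho r M \<in> rep_hom k P (L M) (R M)"
proof (rule rep_homI)
  fix a b l assume *: "a \<in> carrier P" "b \<in> carrier P" "a \<sqsubseteq> b" "l \<in> carrier (Ob (L M) a)"
  then show "Mp (R M) a b (e_map k P rho r M a l) = e_map k P rho r M b (Mp (L M) a b l)"
    by (simp add: e_map_apply compose_eq is_rep_closed[OF is_rep_L[OF M]]
        rep_hom_closed[OF eta_L_hom[OF M]] rep_hom_natural[OF eta_R_hom[OF M]]
        rep_hom_natural[OF eta_L_hom[OF M]])
qed (simp_all add: e_map_lin[OF M], simp add: e_map_def rep_comp_def)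

text \<open>On the generator \<open>\<alpha> M a x m\<close> the adjoint takes the value
  \<open>p x m a\<close>, so \<open>sharp\<close> disappears and an equation between elements
  remains. It serves for both interleaving identities, with the roles of M and N exchanged.\<close>

lemma e_map_eqI:
  assumes M: "is_rep k P M" and N: "is_rep k P N"
    and p: "p \<in> rep_hom k P M (R N)" and q: "q \<in> rep_hom k P N (R M)"
    and eq: "\<And>a x m. \<lbrakk>a \<in> carrier P; x \<in> D a; m \<in> carrier (Ob M x)\<rbrakk>
      \<Longrightarrow> q a (p x m a) = \<eta>R M a (Mp M x a m)"
  shows "e_map k P rho r M = rep_comp P (L M) q (sharp k P rho r M N p)"
proof (rule extensionalityI)
  fix a assume a: "a \<in> carrier P"
  have "e_map k P rho r M a = compose (carrier (Ob (L M) a)) (q a) (sharp k P rho r M N p a)"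
  proof (rule L_ext[OF M e_map_lin[OF M a] lin_maps_compose[OF rep_hom_lin[OF q a]] module_R[OF M]])
    show "sharp k P rho r M N p a \<in> lin_maps k (Ob (L M) a) (Ob N a)"
      by (rule rep_hom_lin[OF sharp_hom[OF M N p] a])
    show "e_map k P rho r M a (\<alpha> M a x m)
      = compose (carrier (Ob (L M) a)) (q a) (sharp k P rho r M N p a) (\<alpha> M a x m)"
      if "x \<in> D a" "m \<in> carrier (Ob M x)" for x m
      using that a
      by (simp add: e_map_alpha[OF M] compose_eq alpha_closed[OF M] sharp_alpha[OF M N p] eq)
  qed (rule module_L[OF M])
  with a show "e_map k P rho r M a = rep_comp P (L M) q (sharp k P rho r M N p) a"
    by (simp add: rep_comp_def)
qed (auto simp: e_map_def rep_comp_def)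

text \<open>The element is the value of \<open>\<eta>L M a\<close> at
  \<open>\<alpha> M a x m\<close>.\<close>

lemma Im_rI:
  assumes M: "is_rep k P M" and "a \<in> carrier P" "x \<in> D a" "m \<in> carrier (Ob M x)"
  shows "Mp M x a m \<in> Im_r k P rho r M a"
  unfolding Im_r_def im_fam_def using assms
  by (metis eta_L_alpha alpha_closed image_eqI)

lemma Ker_r_iff:
  "a \<in> carrier P \<Longrightarrow> m \<in> Ker_r P rho r M a \<longleftrightarrow> m \<in> carrier (Ob M a) \<and> \<eta>R M a m = \<zero>\<^bsub>Ob (R M) a\<^esub>"
  by (simp add: Ker_r_def ker_fam_def a_kernel_iff)

text \<open>Surjectivity of f defines q on all of N, the kernel condition makes q well defined, and
  the bound \<open>Im\<close> makes p defined on all of M although f lives on \<open>M1\<close>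
  only.\<close>

lemma height_interleaved_subquotient:
  fixes M :: "('p, 'k, 'v) rep" and N :: "('p, 'k, 'w) rep"
  assumes M: "is_rep k P M" and N: "is_rep k P N" and M1: "is_subrep k P M1 M"
    and Im: "\<And>a. a \<in> carrier P \<Longrightarrow> Im_r k P rho r M a \<subseteq> M1 a"
    and f: "f \<in> rep_hom k P (sub_rep M M1) N"
    and surj: "\<And>a. a \<in> carrier P \<Longrightarrow> f a ` M1 a = carrier (Ob N a)"
    and ker: "\<And>a m. \<lbrakk>a \<in> carrier P; m \<in> M1 a; f a m = \<zero>\<^bsub>Ob N a\<^esub>\<rbrakk> \<Longrightarrow> m \<in> Ker_r P rho r M a"
  shows "height_interleaved k P rho r M N"
proof -
  have sub: "m \<in> carrier (Ob M a)" if "a \<in> carrier P" "m \<in> M1 a" for a m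
    using is_subrep_subset[OF M1] that by blast
  have M1_Mp: "Mp M a b m \<in> M1 b" if "a \<in> carrier P" "b \<in> carrier P" "a \<sqsubseteq> b" "m \<in> M1 a" for a b m
    using is_subrepD(2)[OF M1 that] .
  \<comment> \<open>Since y in U a means a in D y, \<open>Im_rI\<close> applies at y.\<close>
  have in_M1: "Mp M a y m \<in> M1 y" if "a \<in> carrier P" "y \<in> U a" "m \<in> carrier (Ob M a)" for a y m
    using that Im[of y] Im_rI[OF M, of y a m] down_iff_up upD by blast
  \<comment> \<open>\<open>sub_rep\<close> changes only the carrier and restricts the structure
    maps; this fact and those on f that follow restate the properties of f with the operations of
    M.\<close>
  have f_closed: "f a m \<in> carrier (Ob N a)" if "a \<in> carrier P" "m \<in> M1 a" for a m
    using rep_hom_closed[OF f that(1), of m] that by (simp add: Ob_sub_rep)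
  have f_add: "f a (m \<oplus>\<^bsub>Ob M a\<^esub> n) = f a m \<oplus>\<^bsub>Ob N a\<^esub> f a n"
    if "a \<in> carrier P" "m \<in> M1 a" "n \<in> M1 a" for a m n
    using lin_maps_add[OF rep_hom_lin[OF f that(1)], of m n] that by (simp add: Ob_sub_rep)
  have f_smult: "f a (c \<odot>\<^bsub>Ob M a\<^esub> m) = c \<odot>\<^bsub>Ob N a\<^esub> f a m"
    if "a \<in> carrier P" "c \<in> carrier k" "m \<in> M1 a" for a c m
    using lin_maps_smult[OF rep_hom_lin[OF f that(1)], of c m] that by (simp add: Ob_sub_rep)
  have f_nat: "Mp N a b (f a m) = f b (Mp M a b m)"
    if "a \<in> carrier P" "b \<in> carrier P" "a \<sqsubseteq> b" "m \<in> M1 a" for a b m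
    using rep_hom_natural[OF f that(1-3), of m] that by (simp add: Ob_sub_rep Mp_sub_rep)
  have etaR_lin: "\<eta>R M a \<in> lin_maps k (Ob M a) (Ob (R M) a)" if "a \<in> carrier P" for a
    by (rule rep_hom_lin[OF eta_R_hom[OF M] that])
  note M1_module = is_rep_module[OF M] is_subrepD(1)[OF M1]
  have M1_add: "m \<oplus>\<^bsub>Ob M a\<^esub> n \<in> M1 a" if "a \<in> carrier P" "m \<in> M1 a" "n \<in> M1 a" for a m n
    using module.submoduleE(5)[OF M1_module] that by blast
  have M1_smult: "c \<odot>\<^bsub>Ob M a\<^esub> m \<in> M1 a" if "a \<in> carrier P" "c \<in> carrier k" "m \<in> M1 a" for a c m
    using module.submoduleE(4)[OF M1_module] that by blast
  have eta_eq: "\<eta>R M a m = \<eta>R M a n"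
    if a: "a \<in> carrier P" and mn: "m \<in> M1 a" "n \<in> M1 a" and eq: "f a m = f a n" for a m n
  proof -
    interpret Ma: module k "Ob M a" by (rule is_rep_module[OF M a])
    interpret Na: module k "Ob N a" by (rule is_rep_module[OF N a])
    interpret Ra: module k "Ob (R M) a" by (rule module_R[OF M])
    \<comment> \<open>The difference is written with the scalar -1 because f is known to respect
      sums and multiples within \<open>M1 a\<close>; it is turned into a subtraction of M only for
      \<open>\<eta>R\<close>.\<close>
    let ?d = "m \<oplus>\<^bsub>Ob M a\<^esub> (\<ominus>\<^bsub>k\<^esub> \<one>\<^bsub>k\<^esub>) \<odot>\<^bsub>Ob M a\<^esub> n"
    have d: "?d \<in> M1 a" using a mn by (simp add: M1_add M1_smult)
    have "f a ?d = \<zero>\<^bsub>Ob N a\<^esub>"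
      using a mn eq by (simp add: f_add f_smult M1_add M1_smult f_closed Na.smult_l_minus Na.M.r_neg)
    then have "\<eta>R M a ?d = \<zero>\<^bsub>Ob (R M) a\<^esub>"
      using ker[OF a d] by (simp add: Ker_r_iff[OF a])
    moreover have "?d = m \<ominus>\<^bsub>Ob M a\<^esub> n"
      using mn sub[OF a] by (simp add: Ma.smult_l_minus a_minus_def)
    ultimately show ?thesis
      using mn sub[OF a] lin_maps_minus[OF Ma.module_axioms Ra.module_axioms etaR_lin[OF a]]
      by (simp add: Ra.minus_eq_zero_iff lin_maps_closed[OF etaR_lin[OF a]])
  qed
  define p where "p = (\<lambda>a\<in>carrier P. \<lambda>m\<in>carrier (Ob M a). \<lambda>y\<in>U a. f y (Mp M a y m))"
  \<comment> \<open>Any preimage would do: by \<open>eta_eq\<close> the value does not depend on it,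
    as \<open>q_f\<close> records.\<close>
  define q where "q = (\<lambda>a\<in>carrier P. \<lambda>n\<in>carrier (Ob N a). \<eta>R M a (inv_into (M1 a) (f a) n))"
  have p_apply: "p a m y = f y (Mp M a y m)"
    if "a \<in> carrier P" "m \<in> carrier (Ob M a)" "y \<in> U a" for a m y
    using that by (simp add: p_def)
  have q_f: "q a (f a m) = \<eta>R M a m" if "a \<in> carrier P" "m \<in> M1 a" for a m
  proof -
    have "\<eta>R M a (inv_into (M1 a) (f a) (f a m)) = \<eta>R M a m"
      using that by (intro eta_eq) (auto intro: inv_into_into f_inv_into_f)
    with that show ?thesis by (simp add: q_def f_closed)
  qed
  have ex: "\<exists>m\<in>M1 a. n = f a m" if "a \<in> carrier P" "n \<in> carrier (Ob N a)" for a n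
    using surj[OF that(1)] that(2) by auto
  have p: "p \<in> rep_hom k P M (R N)"
  proof (rule rep_hom_R_I[OF N M])
    fix a assume a: "a \<in> carrier P"
    have lin: "(\<lambda>m\<in>carrier (Ob M a). f y (Mp M a y m)) \<in> lin_maps k (Ob M a) (Ob N y)"
      if y: "y \<in> U a" for y
    proof -
      interpret Ma: module k "Ob M a" by (rule is_rep_module[OF M a])
      note Mp_lin = is_rep_lin[OF M a upD[OF y]]
      show ?thesis
        by (rule lin_mapsI) (use y upD[OF y] a in \<open>auto simp: in_M1 f_closed f_add f_smult
          lin_maps_add[OF Mp_lin] lin_maps_smult[OF Mp_lin]\<close>)
    qed
    have "(\<lambda>m\<in>carrier (Ob M a). \<lambda>y\<in>U a. (\<lambda>m\<in>carrier (Ob M a). f y (Mp M a y m)) m)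
        \<in> lin_maps k (Ob M a) (Ob (R N) a)"
      using a by (intro lin_maps_R_I[OF N] is_rep_module[OF M] lin)
        (auto simp: f_nat in_M1 upD is_rep_comp[OF M])
    also have "(\<lambda>m\<in>carrier (Ob M a). \<lambda>y\<in>U a. (\<lambda>m\<in>carrier (Ob M a). f y (Mp M a y m)) m) = p a"
      using a by (auto simp: p_def intro!: restrict_ext)
    finally show "p a \<in> lin_maps k (Ob M a) (Ob (R N) a)" .
  next
    fix a b y m assume *: "a \<in> carrier P" "b \<in> carrier P" "a \<sqsubseteq> b" "y \<in> U b" "m \<in> carrier (Ob M a)"
    moreover have "y \<in> U a" using up_antimono * by blast
    ultimately show "p a m y = p b (Mp M a b m) y"
      by (simp add: p_apply is_rep_closed[OF M] is_rep_comp[OF M] upD)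
  qed (simp add: p_def)
  have q: "q \<in> rep_hom k P N (R M)"
  proof (rule rep_homI)
    fix a assume a: "a \<in> carrier P"
    show "q a \<in> lin_maps k (Ob N a) (Ob (R M) a)"
    proof (rule lin_mapsI)
      have "q a n \<in> carrier (Ob (R M) a)" if "n \<in> carrier (Ob N a)" for n
        using ex[OF a that] a lin_maps_closed[OF etaR_lin[OF a]] by (auto simp: q_f sub)
      with a show "q a \<in> carrier (Ob N a) \<rightarrow>\<^sub>E carrier (Ob (R M) a)"
        by (auto simp: q_def)
    next
      fix u v assume "u \<in> carrier (Ob N a)" "v \<in> carrier (Ob N a)"
      then obtain m n where "m \<in> M1 a" "u = f a m" "n \<in> M1 a" "v = f a n"
        using ex[OF a] by metis
      then show "q a (u \<oplus>\<^bsub>Ob N a\<^esub> v) = q a u \<oplus>\<^bsub>Ob (R M) a\<^esub> q a v"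
        using a by (simp add: q_f M1_add M1_smult sub lin_maps_add[OF etaR_lin] flip: f_add)
    next
      fix c v assume "c \<in> carrier k" "v \<in> carrier (Ob N a)"
      then show "q a (c \<odot>\<^bsub>Ob N a\<^esub> v) = c \<odot>\<^bsub>Ob (R M) a\<^esub> q a v"
        using a ex[OF a, of v]
        by (auto simp: q_f M1_add M1_smult sub lin_maps_smult[OF etaR_lin] simp flip: f_smult)
    qed
  next
    fix a b n assume *: "a \<in> carrier P" "b \<in> carrier P" "a \<sqsubseteq> b" "n \<in> carrier (Ob N a)"
    then show "Mp (R M) a b (q a n) = q b (Mp N a b n)"
      using ex[OF *(1,4)] by (auto simp: q_f f_nat M1_Mp sub rep_hom_natural[OF eta_R_hom[OF M]])
  qed (simp add: q_def)
  \<comment> \<open>The entry of \<open>p x m\<close> at a is f applied to M(x \<le> a)(m), an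
    element of \<open>M1 a\<close>, and \<open>q_f\<close> undoes f.\<close>
  have 1: "q a (p x m a) = \<eta>R M a (Mp M x a m)"
    if "a \<in> carrier P" "x \<in> D a" "m \<in> carrier (Ob M x)" for a x m
  proof -
    have x: "x \<in> carrier P" "a \<in> U x" using that down_iff_up downD by blast+
    then show ?thesis using that by (simp add: p_apply q_f in_M1)
  qed
  have 2: "p a (q x n a) = \<eta>R N a (Mp N x a n)"
    if a: "a \<in> carrier P" and xD: "x \<in> D a" and n: "n \<in> carrier (Ob N x)" for a x n
  proof -
    have x: "x \<in> carrier P" "a \<in> U x" "x \<sqsubseteq> a" using a xD down_iff_up downD by blast+
    obtain m where m: "m \<in> M1 x" "n = f x m" using ex[OF x(1) n] by blast
    \<comment> \<open>Since q sends f x m to \<open>\<eta>R M x m\<close>, its entry at a is M(x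
      \<le> a)(m). Applying p maps this along a \<le> y and then by f; as m lies in
      \<open>M1 x\<close>, naturality of f moves both structure maps over to N.\<close>
    have "p a (q x n a) = p a (Mp M x a m)"
      using a x m by (simp add: q_f eta_R_apply[OF M] sub)
    also have "\<dots> = (\<lambda>y\<in>U a. f y (Mp M a y (Mp M x a m)))"
      using a x m by (simp add: p_def is_rep_closed[OF M] sub)
    also have "\<dots> = (\<lambda>y\<in>U a. Mp N a y (Mp N x a n))"
      using a x m by (intro restrict_ext) (simp add: f_nat M1_Mp upD)
    also have "\<dots> = \<eta>R N a (Mp N x a n)"
      using a x n by (simp add: eta_R_apply[OF N] is_rep_closed[OF N])
    finally show ?thesis .
  qed
  show ?thesis
    unfolding height_interleaved_def
    using p q e_map_eqI[OF M N p q 1] e_map_eqI[OF N M q p 2] by blast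
qed

lemma EN_height_interleaved:
  fixes M :: "('p, 'k, 'v) rep" and N :: "('p, 'k, 'w) rep"
  assumes M: "is_rep k P M" and "N \<in> EN k P rho r M"
  shows "height_interleaved k P rho r M N"
proof -
  obtain M1 M2 where N: "is_rep k P N" and M1: "is_subrep k P M1 M" and M2: "is_subrep k P M2 M"
    and sub: "\<And>a. a \<in> carrier P \<Longrightarrow> M2 a \<subseteq> M1 a"
    and Im: "\<And>a. a \<in> carrier P \<Longrightarrow> Im_r k P rho r M a \<subseteq> M1 a"
    and Ker: "\<And>a. a \<in> carrier P \<Longrightarrow> M2 a \<subseteq> Ker_r P rho r M a"
    and iso: "rep_iso k P N (quot_rep (sub_rep M M1) M2)"
    using assms(2) unfolding EN_def by blast
  obtain f where f: "f \<in> rep_hom k P (sub_rep M M1) N"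
    and surj: "\<And>a. a \<in> carrier P \<Longrightarrow> f a ` M1 a = carrier (Ob N a)"
    and ker: "\<And>a m. \<lbrakk>a \<in> carrier P; m \<in> M1 a; f a m = \<zero>\<^bsub>Ob N a\<^esub>\<rbrakk> \<Longrightarrow> m \<in> M2 a"
    using quot_rep_proj[OF is_rep_sub_rep[OF M M1] is_subrep_sub_rep[OF M M1 M2 sub] N iso]
    by (auto simp: Ob_sub_rep)
  show ?thesis
    by (rule height_interleaved_subquotient[OF M N M1 Im f surj]) (use Ker ker in blast)+
qed

lemma erosion_rep:
  assumes M: "is_rep k P M"
  shows "is_rep k P (erosion k P rho r M)"
  unfolding erosion_def
  by (intro is_rep_sub_rep is_subrep_im_fam is_rep_R is_rep_L e_map_hom M)

text \<open>The homomorphism theorem is applied to \<open>\<eta>R M\<close> on \<open>Im_r\<close>;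
  intersecting the kernel with \<open>Im_r\<close> is what makes it a subrepresentation of
  \<open>sub_rep M (Im_r k P rho r M)\<close>.\<close>

lemma erosion_in_EN:
  fixes M :: "('p, 'k, 'v) rep"
  assumes M: "is_rep k P M"
  shows "erosion k P rho r M \<in> EN k P rho r M"
proof -
  let ?I = "Im_r k P rho r M" and ?K = "Ker_r P rho r M" and ?E = "erosion k P rho r M"
  have I: "is_subrep k P ?I M"
    unfolding Im_r_def by (rule is_subrep_im_fam[OF is_rep_L[OF M] M eta_L_hom[OF M]])
  have K: "is_subrep k P ?K M"
    unfolding Ker_r_def by (rule is_subrep_ker_fam[OF M is_rep_R[OF M] eta_R_hom[OF M]])
  have IK: "is_subrep k P (\<lambda>a. ?I a \<inter> ?K a) M"
    by (rule is_subrep_inter[OF M I K])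
  have sub: "m \<in> carrier (Ob M a)" if "a \<in> carrier P" "m \<in> ?I a" for a m
    using is_subrep_subset[OF I] that by blast
  have Im_e: "im_fam (L M) (e_map k P rho r M) a = \<eta>R M a ` ?I a" if "a \<in> carrier P" for a
    using that by (simp add: im_fam_def Im_r_def e_map_apply image_image compose_eq cong: image_cong)
  have Ob_E: "Ob ?E a = (Ob (R M) a)\<lparr>carrier := \<eta>R M a ` ?I a\<rparr>" if "a \<in> carrier P" for a
    using that by (simp add: erosion_def Ob_sub_rep Im_e)
  have Mp_E: "Mp ?E a b s = Mp (R M) a b s" if "a \<in> carrier P" "s \<in> \<eta>R M a ` ?I a" for a b s
    using that by (simp add: erosion_def Mp_sub_rep Im_e)
  \<comment> \<open>Morphisms are extensional, so \<open>\<eta>R M a\<close> has to be restricted to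
    the smaller domain.\<close>
  define f where "f = (\<lambda>a\<in>carrier P. restrict (\<eta>R M a) (?I a))"
  have "rep_iso k P ?E (quot_rep (sub_rep M ?I) (\<lambda>a. ?I a \<inter> ?K a))"
  proof (rule rep_iso_quot_rep[where f = f])
    show "is_rep k P (sub_rep M ?I)" by (rule is_rep_sub_rep[OF M I])
    show "is_subrep k P (\<lambda>a. ?I a \<inter> ?K a) (sub_rep M ?I)"
      by (rule is_subrep_sub_rep[OF M I IK]) simp
    show "is_rep k P ?E" by (rule erosion_rep[OF M])
    show "f \<in> rep_hom k P (sub_rep M ?I) ?E"
    proof (rule rep_homI)
      fix a assume a: "a \<in> carrier P"
      show "f a \<in> lin_maps k (Ob (sub_rep M ?I) a) (Ob ?E a)"
        using a lin_maps_restrict_submodule[OF rep_hom_lin[OF eta_R_hom[OF M] a]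
            is_rep_module[OF M a] is_subrepD(1)[OF I a] order_refl]
        by (simp add: f_def Ob_sub_rep Ob_E)
    next
      fix a b m
      assume *: "a \<in> carrier P" "b \<in> carrier P" "a \<sqsubseteq> b" "m \<in> carrier (Ob (sub_rep M ?I) a)"
      then show "Mp ?E a b (f a m) = f b (Mp (sub_rep M ?I) a b m)"
        using is_subrepD(2)[OF I, of a b m]
        by (simp add: f_def Ob_sub_rep Mp_sub_rep Mp_E rep_hom_natural[OF eta_R_hom[OF M]] sub)
    qed (simp add: f_def)
    show "f a ` carrier (Ob (sub_rep M ?I) a) = carrier (Ob ?E a)" if "a \<in> carrier P" for a
      using that by (simp add: f_def Ob_sub_rep Ob_E)
    \<comment> \<open>The erosion keeps the zero of R M, so vanishing of f is membership in
      \<open>Ker_r\<close>.\<close>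
    show "f a m = \<zero>\<^bsub>Ob ?E a\<^esub> \<longleftrightarrow> m \<in> ?I a \<inter> ?K a"
      if "a \<in> carrier P" "m \<in> carrier (Ob (sub_rep M ?I) a)" for a m
      using that by (simp add: f_def Ob_sub_rep Ob_E Ker_r_iff sub)
  qed
  with erosion_rep[OF M] I IK show ?thesis
    unfolding EN_def by blast
qed

end

theorem theorem6p7:
  fixes k :: "'k ring"
    and P :: "'p gorder"
    and rho :: "'p \<Rightarrow> 'p \<Rightarrow> ennreal"
    and M :: "('p, 'k, 'v) rep"
    and r :: real
  assumes "field k"
    and "height_difference P rho"
    and "is_rep k P M"
    and "0 \<le> r"
  shows "erosion k P rho r M \<in> EN k P rho r M \<and>
    (\<forall>N :: ('p, 'k, 'w) rep. N \<in> EN k P rho r M \<longrightarrow> height_interleaved k P rho r M N) \<and>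
    height_interleaved k P rho r M (erosion k P rho r M)"
proof -
  have "cring k"
    using assms(1) by (simp add: field.axioms(1) domain.axioms(1))
  then interpret height_setting P rho k r
    using assms(2) by (intro height_setting.intro height_setting_axioms.intro)
  \<comment> \<open>The second conjunct fixes the element type 'w of N, while the erosion has
    elements of type 'p \<Rightarrow> 'v; the third conjunct is therefore a separate instance of
    \<open>EN_height_interleaved\<close>.\<close>
  show ?thesis
    by (intro conjI allI impI EN_height_interleaved erosion_in_EN assms(3))
qed

end
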